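(* Let $n\geq 2$ and let $G(J(P_n)^2)=\{U_1,\ldots,U_p\}$, indexed so that $U_1>_{\mathcal R}U_2>_{\mathcal R}\cdots>_{\mathcal R}U_p$ in the rooted order on $F(J(P_n)^2)$. Then $J(P_n)^2$ has linear quotients with respect to the order $U_1,\ldots,U_p$; that is, for every $2\leq r\leq p$ the colon ideal $(U_1,\ldots,U_{r-1}):(U_r)$ is generated by a subset of $\{x_1,\ldots,x_n\}$.
   Context: Let $K$ be a field and $S=K[x_1,\ldots,x_n]$. For $m\geq 1$, $P_m$ is the path graph on vertices $x_1,\ldots,x_m$ with edges $\{x_i,x_{i+1}\}$, $1\leq i\leq m-1$. A vertex cover is a set of vertices meeting every edge; it is minimal if no proper subset is a vertex cover. The cover ideal $J(P_m)$ is generated by the monomials $\prod_{x\in C}x$ with $C$ a minimal vertex cover of $P_m$. For a monomial ideal $I$, $G(I)$ is its set of minimal monomial generators and $F(I^2)=\{uv: u,v\in G(I)\}$. The rooted list $\mathcal R(P_m)$ is defined recursively: $\mathcal R(P_1)$ is the empty list; $\mathcal R(P_2)=x_1,x_2$; $\mathcal R(P_3)=x_2,x_1x_3$; $\mathcal R(P_4)=x_1x_3,x_2x_3,x_2x_4$; for $m\geq5$, if $\mathcal R(P_{m-2})=u_1,\ldots,u_r$ and $\mathcal R(P_{m-3})=v_1,\ldots,v_s$, then $\mathcal R(P_m)=x_{m-1}u_1,\ldots,x_{m-1}u_r,x_mx_{m-2}v_1,\ldots,x_mx_{m-2}v_s$. For $m\geq2$ this lists each element of $G(J(P_m))$ exactly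 once. If $\mathcal R(P_m)=w_1,\ldots,w_t$, the rooted order on $G(J(P_m))$ is $w_i>_{\mathcal R}w_j$ iff $i<j$. Writing $\mathcal R(P_m)=u_1,\ldots,u_q$, each $M\in F(J(P_m)^2)$ can be written as $u_1^{a_1}\cdots u_q^{a_q}$ with $a_i\geq0$, $\sum a_i=2$; the maximal expression of $M$ is the one whose exponent vector $(a_1,\ldots,a_q)$ is lexicographically largest (first nonzero entry of the difference positive). The rooted order on $F(J(P_m)^2)$: $M>_{\mathcal R}N$ iff the exponent vector of the maximal expression of $M$ is lexicographically larger than that of $N$. *)

theory Defs
  imports Main "HOL-Library.Poly_Mapping"
begin

(* Monomials (exponent vectors) in the variables x_1, x_2, ... : nat \<Rightarrow>\<^sub>0 nat.
   The product of monomials is the sum of exponent vectors.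
   Polynomials over a field K: (nat \<Rightarrow>\<^sub>0 nat) \<Rightarrow>\<^sub>0 'a. *)

type_synonym mon = "nat \<Rightarrow>\<^sub>0 nat"
type_synonym 'a mpoly = "mon \<Rightarrow>\<^sub>0 'a"

definition var :: "nat \<Rightarrow> mon" where
  "var i = Poly_Mapping.single i 1"

definition xmon :: "mon \<Rightarrow> 'a::field mpoly" where
  "xmon u = Poly_Mapping.single u 1"

definition Sring :: "nat \<Rightarrow> 'a::field mpoly set" where
  "Sring n = {f::'a mpoly. \<forall>u\<in>Poly_Mapping.keys f. Poly_Mapping.keys (u::mon) \<subseteq> {1..n}}"

definition ideal_gen :: "nat \<Rightarrow> 'a::field mpoly set \<Rightarrow> 'a mpoly set" where
  "ideal_gen n G = {(\<Sum>g\<in>H. c g * g) | H c. finite H \<and> H \<subseteq> G \<and> (\<forall>g\<in>H. c g \<in> Sring n)}"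

definition ideal_prod :: "nat \<Rightarrow> 'a::field mpoly set \<Rightarrow> 'a mpoly set \<Rightarrow> 'a mpoly set" where
  "ideal_prod n I J = ideal_gen n {f * g | f g. f \<in> I \<and> g \<in> J}"

definition colon :: "nat \<Rightarrow> 'a::field mpoly set \<Rightarrow> 'a mpoly \<Rightarrow> 'a mpoly set" where
  "colon n I f = {g \<in> Sring n. g * f \<in> I}"

definition mdvd :: "mon \<Rightarrow> mon \<Rightarrow> bool" where
  "mdvd v u \<longleftrightarrow> (\<forall>i. Poly_Mapping.lookup v i \<le> Poly_Mapping.lookup u i)"

definition min_mon_gens :: "nat \<Rightarrow> 'a::field mpoly set \<Rightarrow> mon set" where
  "min_mon_gens n I = {u. Poly_Mapping.keys u \<subseteq> {1..n} \<and> xmon u \<in> I \<and>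
      (\<forall>v. xmon v \<in> I \<and> mdvd v u \<longrightarrow> v = u)}"

(* path graph P_m on x_1..x_m; vertex covers as subsets of {1..m} *)
definition vertex_cover :: "nat \<Rightarrow> nat set \<Rightarrow> bool" where
  "vertex_cover m C \<longleftrightarrow> C \<subseteq> {1..m} \<and> (\<forall>i. 1 \<le> i \<and> i < m \<longrightarrow> i \<in> C \<or> Suc i \<in> C)"

definition min_vertex_cover :: "nat \<Rightarrow> nat set \<Rightarrow> bool" where
  "min_vertex_cover m C \<longleftrightarrow> vertex_cover m C \<and> (\<forall>D. D \<subset> C \<longrightarrow> \<not> vertex_cover m D)"

definition cover_mon :: "nat set \<Rightarrow> mon" where
  "cover_mon C = (\<Sum>i\<in>C. var i)"

definition cover_ideal :: "nat \<Rightarrow> 'a::field mpoly set" where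
  "cover_ideal m = ideal_gen m {xmon (cover_mon C) | C. min_vertex_cover m C}"

definition cover_ideal_sq :: "nat \<Rightarrow> 'a::field mpoly set" where
  "cover_ideal_sq m = ideal_prod m (cover_ideal m) (cover_ideal m)"

fun rooted :: "nat \<Rightarrow> mon list" where
  "rooted 0 = []"
| "rooted (Suc 0) = []"
| "rooted (Suc (Suc 0)) = [var 1, var 2]"
| "rooted (Suc (Suc (Suc 0))) = [var 2, var 1 + var 3]"
| "rooted (Suc (Suc (Suc (Suc 0)))) = [var 1 + var 3, var 2 + var 3, var 2 + var 4]"
| "rooted (Suc (Suc (Suc (Suc (Suc k))))) =
     map (\<lambda>u. var (k + 4) + u) (rooted (k + 3)) @
     map (\<lambda>v. var (k + 5) + var (k + 3) + v) (rooted (k + 2))"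

definition expr_mon :: "nat \<Rightarrow> nat list \<Rightarrow> mon" where
  "expr_mon m a = (\<Sum>i<length (rooted m). sum_list (replicate (a ! i) (rooted m ! i)))"

definition exprs :: "nat \<Rightarrow> mon \<Rightarrow> nat list set" where
  "exprs m M = {a. length a = length (rooted m) \<and> sum_list a = 2 \<and> expr_mon m a = M}"

(* a is lexicographically larger than b (equal lengths) *)
definition lex_gt :: "nat list \<Rightarrow> nat list \<Rightarrow> bool" where
  "lex_gt a b \<longleftrightarrow> (\<exists>k < length a. take k a = take k b \<and> a ! k > b ! k)"

definition max_expr :: "nat \<Rightarrow> mon \<Rightarrow> nat list" where
  "max_expr m M = (THE a. a \<in> exprs m M \<and> (\<forall>b\<in>exprs m M. b \<noteq> a \<longrightarrow> lex_gt a b))"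

definition rooted_gt :: "nat \<Rightarrow> mon \<Rightarrow> mon \<Rightarrow> bool" where
  "rooted_gt m M N \<longleftrightarrow> lex_gt (max_expr m M) (max_expr m N)"

end

theory Submission
  imports Defs
begin

text \<open>
  A monomial lies in \<open>J(P\<^sub>n)\<^sup>2\<close> iff its exponent vector is a 2-cover of the path, so the minimal
  generators are the minimal 2-covers \<open>M\<close>. The rooted order on minimal covers is reverse
  lexicographic, so the maximal expression of \<open>M\<close> is the splitting \<open>M = C + D\<close> into covers in which
  \<open>C\<close> omits the last vertex of every run of ones of \<open>M\<close>. The colon ideal of \<open>M\<close> is generated by those
  \<open>x\<^sub>k\<close> for which \<open>M\<close> has positive weight at \<open>k + 1\<close> and the edge from \<open>k + 1\<close> to the right, if it
  exists, has total weight above 2. For such \<open>k\<close>, shifting weight from \<open>k + 1\<close> to \<open>k\<close> yields an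
  earlier generator dividing \<open>x\<^sub>k M\<close>. Conversely, if a generator \<open>N\<close> does not exceed \<open>M\<close> at any such
  \<open>k\<close>, the cover condition forces \<open>N\<close> to dominate \<open>M\<close> at all vertices \<open>k + 1\<close>, and comparing the
  splittings from the right shows that \<open>N\<close> does not precede \<open>M\<close>.
\<close>

section \<open>Weighted covers of a path and the reverse lexicographic order\<close>

definition path_cover :: "nat \<Rightarrow> nat \<Rightarrow> (nat \<Rightarrow> nat) \<Rightarrow> bool" where
  "path_cover d n f \<longleftrightarrow> (\<forall>i. 0 < f i \<longrightarrow> 1 \<le> i \<and> i \<le> n) \<and>
     (\<forall>i. 1 \<le> i \<and> i < n \<longrightarrow> d \<le> f i + f (Suc i))"

text \<open>Local form of minimality: a positive weight can be lowered by one exactly when no edge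
  at its vertex has total weight \<open>d\<close>, so these are the \<open>d\<close>-covers that are
  minimal pointwise. For \<open>d = 2\<close> they turn out to be the exponents of the minimal
  generators of the squared ideal.\<close>

definition tight_cover :: "nat \<Rightarrow> nat \<Rightarrow> (nat \<Rightarrow> nat) \<Rightarrow> bool" where
  "tight_cover d n f \<longleftrightarrow> path_cover d n f \<and>
     (\<forall>i. 0 < f i \<longrightarrow> (1 < i \<and> f (i - 1) + f i = d) \<or> (i < n \<and> f i + f (Suc i) = d))"

text \<open>Reverse lexicographic order without the usual prior comparison of degrees. On the rooted
  list it agrees with the order of the list (\<open>rooted_sorted\<close>).\<close>

definition revlex_gt :: "(nat \<Rightarrow> nat) \<Rightarrow> (nat \<Rightarrow> nat) \<Rightarrow> bool" where
  "revlex_gt f g \<longleftrightarrow> (\<exists>q. f q < g q \<and> (\<forall>p>q. f p = g p))"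

lemma path_cover_outside: "path_cover d n f \<Longrightarrow> \<not> (1 \<le> i \<and> i \<le> n) \<Longrightarrow> f i = 0"
  unfolding path_cover_def by blast

lemma path_cover_edge: "path_cover d n f \<Longrightarrow> 1 \<le> i \<Longrightarrow> i < n \<Longrightarrow> d \<le> f i + f (Suc i)"
  unfolding path_cover_def by blast

lemma tight_cover_imp_path_cover: "tight_cover d n f \<Longrightarrow> path_cover d n f"
  unfolding tight_cover_def by blast

lemma tight_coverD:
  "tight_cover d n f \<Longrightarrow> 0 < f i \<Longrightarrow> (1 < i \<and> f (i - 1) + f i = d) \<or> (i < n \<and> f i + f (Suc i) = d)"
  unfolding tight_cover_def by blast

lemma tight_cover_le: "tight_cover d n f \<Longrightarrow> f i \<le> d"
  using tight_coverD[of d n f i] by (cases "f i = 0") auto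

lemma revlex_gt_asym: "revlex_gt f g \<Longrightarrow> \<not> revlex_gt g f"
  unfolding revlex_gt_def by (metis linorder_neqE_nat order_less_asym less_irrefl)

lemma largest_difference:
  fixes f g :: "nat \<Rightarrow> nat"
  assumes "f \<noteq> g" and "\<And>p. p > n \<Longrightarrow> f p = g p"
  obtains q where "f q \<noteq> g q" "\<And>p. p > q \<Longrightarrow> f p = g p"
proof -
  have fin: "finite {q. f q \<noteq> g q}"
    by (rule finite_subset[of _ "{..n}"]) (use assms(2) in \<open>auto simp: not_less[symmetric]\<close>)
  have ne: "{q. f q \<noteq> g q} \<noteq> {}"
    using assms(1) by auto
  show thesis
  proof (rule that[of "Max {q. f q \<noteq> g q}"])
    show "f (Max {q. f q \<noteq> g q}) \<noteq> g (Max {q. f q \<noteq> g q})"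
      using Max_in[OF fin ne] by simp
    show "f p = g p" if "p > Max {q. f q \<noteq> g q}" for p
      using that Max_ge[OF fin, of p] by fastforce
  qed
qed

subsection \<open>The canonical splitting of a 2-cover\<close>

text \<open>A maximal run of ones in a 2-cover is shared alternately by the two covers of any
  factorisation; \<open>upper\<close> is the factor that omits the last vertex of every run.\<close>

function upper :: "nat \<Rightarrow> (nat \<Rightarrow> nat) \<Rightarrow> nat \<Rightarrow> nat" where
  "upper n f i = (if f i = 1 \<and> i < n \<and> f (Suc i) = 1 then 1 - upper n f (Suc i) else f i div 2)"
  by pat_completeness auto
termination by (relation "measure (\<lambda>(n, f, i). n - i)") auto

declare upper.simps [simp del]

definition lower :: "nat \<Rightarrow> (nat \<Rightarrow> nat) \<Rightarrow> nat \<Rightarrow> nat" where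
  "lower n f i = f i - upper n f i"

lemma upper_run: "f i = 1 \<Longrightarrow> i < n \<Longrightarrow> f (Suc i) = 1 \<Longrightarrow> upper n f i = 1 - upper n f (Suc i)"
  by (subst upper.simps) simp

lemma upper_end: "\<not> (f i = 1 \<and> i < n \<and> f (Suc i) = 1) \<Longrightarrow> upper n f i = f i div 2"
  by (subst upper.simps) auto

lemma upper_le: "f i \<le> 2 \<Longrightarrow> upper n f i \<le> 1 \<and> upper n f i \<le> f i \<and> f i \<le> upper n f i + 1"
  by (cases "f i = 1 \<and> i < n \<and> f (Suc i) = 1") (use upper_run[of f i n] upper_end[of f i n] in auto)

lemma upper_eq_2: "f i = 2 \<Longrightarrow> upper n f i = 1"
  by (subst upper.simps) simp

lemma upper_add_lower: "f i \<le> 2 \<Longrightarrow> upper n f i + lower n f i = f i"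
  using upper_le[of f i n] unfolding lower_def by simp

text \<open>The recursion of \<open>upper\<close> only looks to the right, so changes below
  \<open>i\<close> are invisible at \<open>i\<close>. This is what allows splittings to be compared
  from the right end of the path.\<close>

lemma upper_cong_above:
  assumes "\<And>p. p \<ge> i \<Longrightarrow> f p = g p"
  shows "upper n f i = upper n g i"
  using assms
proof (induction "n - i" arbitrary: i)
  case 0
  then show ?case by (simp add: upper.simps[of n _ i])
next
  case (Suc x)
  have "upper n f (Suc i) = upper n g (Suc i)"
    using Suc by (intro Suc.hyps(1)) auto
  with Suc.prems show ?case by (simp add: upper.simps[of n _ i])
qed

text \<open>An edge of a 2-cover with weights at most 2 either has an end of weight 2, which gives 1
  to both factors, or joins two ones of a run, on which the factors alternate.\<close>

lemma upper_cover:
  assumes f: "path_cover 2 n f" and le: "\<And>i. f i \<le> 2"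
  shows "path_cover 1 n (upper n f)" and "path_cover 1 n (lower n f)"
proof -
  have edge: "1 \<le> upper n f i + upper n f (Suc i) \<and> 1 \<le> lower n f i + lower n f (Suc i)"
    if i: "1 \<le> i" "i < n" for i
  proof -
    have s: "2 \<le> f i + f (Suc i)" using path_cover_edge[OF f i] .
    have e: "f j \<le> 2" "upper n f j \<le> 1" "upper n f j \<le> f j" "upper n f j + lower n f j = f j" for j
      using upper_le[of f j n] upper_add_lower[of f j n] le[of j] by auto
    consider "f i = 2" | "f (Suc i) = 2" | "f i = 1" "f (Suc i) = 1"
      using s le[of i] le[of "Suc i"] by linarith
    then show ?thesis
    proof cases
      case 1 then show ?thesis using upper_eq_2[of f i n] e[of i] by simp
    next
      case 2 then show ?thesis using upper_eq_2[of f "Suc i" n] e[of "Suc i"] by simp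
    next
      case 3 then show ?thesis using upper_run[of f i n] i e[of i] e[of "Suc i"] by simp
    qed
  qed
  have supp: "f i = 0 \<Longrightarrow> upper n f i = 0 \<and> lower n f i = 0" for i
    using upper_le[of f i n] unfolding lower_def by simp
  show "path_cover 1 n (upper n f)" "path_cover 1 n (lower n f)"
    using edge supp path_cover_outside[OF f] unfolding path_cover_def by (metis less_irrefl)+
qed

text \<open>On an edge where the product has weight exactly \<open>c + d\<close>, the factors have
  weight at least \<open>c\<close> and at least \<open>d\<close>, so both bounds are equalities.
  Tight edges of the product are thus tight for each factor.\<close>

lemma tight_factor:
  assumes f: "tight_cover (c + d) n f" and g: "path_cover c n g" and h: "path_cover d n h"
    and eq: "\<And>i. f i = g i + h i"
  shows "tight_cover c n g"
  unfolding tight_cover_def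
proof (intro conjI allI impI g)
  fix i assume pos: "0 < g i"
  then have i: "1 \<le> i" "i \<le> n" using path_cover_outside[OF g, of i] by auto
  from pos eq have "0 < f i" by simp
  from tight_coverD[OF f this]
  show "1 < i \<and> g (i - 1) + g i = c \<or> i < n \<and> g i + g (Suc i) = c"
  proof
    assume a: "1 < i \<and> f (i - 1) + f i = c + d"
    then have "c \<le> g (i - 1) + g i" "d \<le> h (i - 1) + h i"
      using path_cover_edge[OF g, of "i - 1"] path_cover_edge[OF h, of "i - 1"] i by auto
    then show ?thesis using a eq[of i] eq[of "i - 1"] by linarith
  next
    assume a: "i < n \<and> f i + f (Suc i) = c + d"
    then have "c \<le> g i + g (Suc i)" "d \<le> h i + h (Suc i)"
      using path_cover_edge[OF g, of i] path_cover_edge[OF h, of i] i by auto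
    then show ?thesis using a eq[of i] eq[of "Suc i"] by linarith
  qed
qed

lemma
  assumes f: "tight_cover 2 n f"
  shows tight_upper: "tight_cover 1 n (upper n f)" and tight_lower: "tight_cover 1 n (lower n f)"
proof -
  note le = tight_cover_le[OF f]
  note cov = upper_cover[OF tight_cover_imp_path_cover[OF f] le]
  have f': "tight_cover (1 + 1) n f" using f by (simp add: numeral_2_eq_2)
  show "tight_cover 1 n (upper n f)"
    by (rule tight_factor[OF f' cov]) (simp add: upper_add_lower le)
  show "tight_cover 1 n (lower n f)"
    by (rule tight_factor[OF f' cov(2) cov(1)]) (simp add: upper_add_lower le add.commute[of "lower _ _ _"])
qed

text \<open>Consider the last vertex \<open>q\<close> where \<open>g\<close> and
  \<open>upper n f\<close> differ, with \<open>g\<close> smaller there. The bound on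
  \<open>h\<close> forces \<open>f q = 1\<close>, so \<open>upper\<close> can be 1 at
  \<open>q\<close> only if \<open>q\<close> is followed in its run by a vertex where
  \<open>upper\<close> is 0. As \<open>g\<close> agrees with \<open>upper\<close> at that vertex, it
  misses the edge between the two.\<close>

lemma upper_greatest:
  assumes g: "path_cover 1 n g" and le: "\<And>i. g i \<le> 1" "\<And>i. h i \<le> 1"
    and eq: "\<And>i. f i = g i + h i" and f: "path_cover 2 n f"
  shows "g = upper n f \<or> revlex_gt (upper n f) g"
proof (rule disjCI, rule ccontr)
  assume nr: "\<not> revlex_gt (upper n f) g" and "\<not> g = upper n f"
  have le2: "f i \<le> 2" for i using le(1)[of i] le(2)[of i] eq[of i] by simp
  have out: "g p = upper n f p" if "p > n" for p
    using that path_cover_outside[OF g, of p] path_cover_outside[OF f, of p] upper_le[of f p n] by simp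
  obtain q where q: "g q \<noteq> upper n f q" "\<And>p. p > q \<Longrightarrow> g p = upper n f p"
    using largest_difference[of g "upper n f" n] out \<open>\<not> g = upper n f\<close> by blast
  then have "\<not> upper n f q < g q" using nr unfolding revlex_gt_def by metis
  with q(1) have lt: "g q = 0" "upper n f q = 1"
    using upper_le[of f q n, OF le2] by auto
  then have "f q = 1" using eq[of q] le(2)[of q] upper_le[of f q n, OF le2] by auto
  with lt(2) have r: "q < n" "f (Suc q) = 1" "upper n f (Suc q) = 0"
    using upper_end[of f q n] upper_run[of f q n] by fastforce+
  have "1 \<le> q" using \<open>f q = 1\<close> path_cover_outside[OF f, of q] by auto
  then show False using path_cover_edge[OF g _ r(1)] lt(1) q(2)[of "Suc q"] r(3) by simp
qed

subsection \<open>Exchange moves on minimal 2-covers\<close>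

text \<open>The right edge of \<open>k + 1\<close> is absent or has weight to spare, so only the
  edge to \<open>k\<close> keeps the weight of \<open>k + 1\<close> from dropping. Raising
  \<open>k\<close> releases it.\<close>

definition movable :: "nat \<Rightarrow> (nat \<Rightarrow> nat) \<Rightarrow> nat set" where
  "movable n f = {k. 1 \<le> k \<and> k < n \<and> 0 < f (Suc k) \<and> (Suc k = n \<or> 2 < f (Suc k) + f (Suc (Suc k)))}"

text \<open>Raising a 2-cover at a movable \<open>k\<close> makes \<open>k + 1\<close>, and possibly also \<open>k - 1\<close>, superfluous.\<close>

definition move :: "nat \<Rightarrow> (nat \<Rightarrow> nat) \<Rightarrow> nat \<Rightarrow> nat" where
  "move k f i = (if i = k then f k + 1 else if i = Suc k then f i - 1
     else if Suc i = k \<and> 0 < f i \<and> (i = 1 \<or> 2 < f (i - 1) + f i) then f i - 1 else f i)"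

text \<open>Tightness demands an edge of weight 2 at \<open>k + 1\<close>, and the right one is
  absent or too heavy.\<close>

lemma movable_sum:
  assumes f: "tight_cover 2 n f" and k: "k \<in> movable n f"
  shows "f k + f (Suc k) = 2"
  using tight_coverD[OF f, of "Suc k"] k unfolding movable_def by auto

text \<open>The edge from \<open>k\<close> to \<open>k + 1\<close> keeps weight 2, and any other
  edge that loses weight was above 2 or is compensated at \<open>k\<close>. For minimality only the
  vertices from \<open>k - 2\<close> to \<open>k + 2\<close> need an argument, since elsewhere the
  adjacent weights are unchanged.\<close>

lemma move_tight:
  assumes f: "tight_cover 2 n f" and k: "k \<in> movable n f"
  shows "tight_cover 2 n (move k f)"
proof -
  note pc = tight_cover_imp_path_cover[OF f]
  note s = movable_sum[OF f k]
  have kk: "1 \<le> k" "k < n" "0 < f (Suc k)" "Suc k = n \<or> 2 < f (Suc k) + f (Suc (Suc k))"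
    using k unfolding movable_def by auto
  have edge: "2 \<le> move k f i + move k f (Suc i)" if i: "1 \<le> i" "i < n" for i
  proof -
    have e: "2 \<le> f i + f (Suc i)" by (rule path_cover_edge[OF pc i])
    show ?thesis
      using e kk s i unfolding move_def by auto
  qed
  have supp: "1 \<le> i \<and> i \<le> n" if "0 < move k f i" for i
    using that path_cover_outside[OF pc, of i] kk unfolding move_def by (auto split: if_splits)
  have tight: "1 < i \<and> move k f (i - 1) + move k f i = 2 \<or> i < n \<and> move k f i + move k f (Suc i) = 2"
    if p: "0 < move k f i" for i
  proof -
    consider "i = k \<or> i = Suc k" | "Suc i = k" | "Suc (Suc i) = k" | "i = Suc (Suc k)"
      | "Suc (Suc i) < k" | "i > Suc (Suc k)" by linarith
    then show ?thesis
    proof cases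
      case 1
      have "move k f k + move k f (Suc k) = 2" using s kk unfolding move_def by simp
      then show ?thesis using 1 kk by auto
    next
      \<comment> \<open>Raising \<open>k\<close> spoils a tight edge between \<open>k - 1\<close>
        and \<open>k\<close>. If the left edge of \<open>k - 1\<close> is tight, nothing is lost;
        otherwise \<open>k - 1\<close> is lowered, which restores the right edge to weight
        2.\<close>
      case 2
      then have "0 < f i" using p unfolding move_def by (auto split: if_splits)
      then have t: "(1 < i \<and> f (i - 1) + f i = 2) \<or> (i < n \<and> f i + f (Suc i) = 2)"
        by (rule tight_coverD[OF f])
      have e: "1 < i \<Longrightarrow> 2 \<le> f (i - 1) + f i"
        using path_cover_edge[OF pc, of "i - 1"] 2 kk by auto
      have "1 \<le> i" using supp[OF p] by simp
      have m: "move k f (i - 1) = f (i - 1)" "move k f (Suc i) = f (Suc i) + 1"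
        using 2 \<open>1 \<le> i\<close> unfolding move_def by auto
      show ?thesis
      proof (cases "i = 1 \<or> 2 < f (i - 1) + f i")
        case True
        then have "move k f i = f i - 1" using 2 \<open>0 < f i\<close> unfolding move_def by auto
        then show ?thesis using t m True \<open>0 < f i\<close> by auto
      next
        case False
        then have "move k f i = f i" using 2 unfolding move_def by auto
        then show ?thesis using m False e \<open>1 \<le> i\<close> by auto
      qed
    next
      \<comment> \<open>If the edge from \<open>k - 2\<close> to \<open>k - 1\<close> is tight, then
        \<open>k - 1\<close> is not lowered, so this edge stays tight.\<close>
      case 3
      have m: "move k f i = f i" "move k f (i - 1) = f (i - 1)" using 3 unfolding move_def by auto
      then have p: "0 < f i" using p by simp
      then have "1 \<le> i" using path_cover_outside[OF pc, of i] by auto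
      then have "move k f (Suc i) = f (Suc i)" if "f i + f (Suc i) = 2"
        using that 3 unfolding move_def by auto
      then show ?thesis using tight_coverD[OF f p] m by auto
    next
      \<comment> \<open>The edge from \<open>k + 1\<close> to \<open>k + 2\<close> had weight above
        2, so \<open>k + 2\<close> owes its tightness to its right edge, which the move does not
        touch.\<close>
      case 4
      have m: "move k f i = f i" "move k f (Suc i) = f (Suc i)" using 4 unfolding move_def by auto
      then have p: "0 < f i" using p by simp
      then have "i \<le> n" using path_cover_outside[OF pc, of i] by auto
      then have "f (i - 1) + f i \<noteq> 2" using kk 4 by auto
      then show ?thesis using tight_coverD[OF f p] m by auto
    next
      case 5
      then have m: "move k f i = f i" "move k f (Suc i) = f (Suc i)" "move k f (i - 1) = f (i - 1)"
        unfolding move_def by auto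
      then show ?thesis using tight_coverD[OF f, of i] p by auto
    next
      case 6
      then have m: "move k f i = f i" "move k f (Suc i) = f (Suc i)" "move k f (i - 1) = f (i - 1)"
        unfolding move_def by auto
      then show ?thesis using tight_coverD[OF f, of i] p by auto
    qed
  qed
  show ?thesis unfolding tight_cover_def path_cover_def using edge supp tight by blast
qed

text \<open>Nothing changes beyond \<open>k + 1\<close>, where the weight drops by one. If
  \<open>upper\<close> drops there, it decides the comparison; otherwise \<open>upper\<close> turns
  out to be unchanged everywhere, and the drop falls on \<open>lower\<close>.\<close>

lemma move_greater:
  assumes f: "tight_cover 2 n f" and k: "k \<in> movable n f"
  shows "revlex_gt (upper n (move k f)) (upper n f) \<or>
    upper n (move k f) = upper n f \<and> revlex_gt (lower n (move k f)) (lower n f)"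
proof -
  define g where "g = move k f"
  note pc = tight_cover_imp_path_cover[OF f]
  note s = movable_sum[OF f k]
  have g: "tight_cover 2 n g" unfolding g_def by (rule move_tight[OF f k])
  have kk: "1 \<le> k" "k < n" "0 < f (Suc k)" "Suc k = n \<or> 2 < f (Suc k) + f (Suc (Suc k))"
    using k unfolding movable_def by auto
  have above: "f p = g p" if "p \<ge> Suc (Suc k)" for p using that unfolding g_def move_def by auto
  have uabove: "upper n g p = upper n f p" if "p \<ge> Suc (Suc k)" for p
    using upper_cong_above[of p g f n] above that by simp
  have gk: "g k = f k + 1" "g (Suc k) = f (Suc k) - 1" unfolding g_def move_def by auto
  note le = tight_cover_le[OF f] tight_cover_le[OF g]
  show ?thesis
  proof (cases "upper n g (Suc k) < upper n f (Suc k)")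
    case True
    then have "revlex_gt (upper n g) (upper n f)"
      unfolding revlex_gt_def using uabove by (intro exI[of _ "Suc k"]) auto
    then show ?thesis unfolding g_def by simp
  next
    case False
    \<comment> \<open>The weights at \<open>k\<close> and \<open>k + 1\<close> change from 0, 2 to
      1, 1 or from 1, 1 to 2, 0. In the second case the weight of \<open>f\<close> after
      \<open>k + 1\<close> is 2 or there is no further vertex, so \<open>k + 1\<close> ends a run
      and \<open>upper n f\<close> is already 0 there.\<close>
    have u1: "upper n g (Suc k) = upper n f (Suc k)"
    proof (cases "f k = 0")
      case True
      then have "f (Suc k) = 2" using s by simp
      then show ?thesis using False upper_eq_2[of f "Suc k" n] upper_le[of g "Suc k" n, OF le(2)] by simp
    next
      case F: False
      then have "f (Suc k) = 1" "f k = 1" using s kk by auto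
      then show ?thesis using False upper_end[of f "Suc k" n] upper_end[of g "Suc k" n] gk kk by auto
    qed
    have u0: "upper n g k = upper n f k"
    proof (cases "f k = 0")
      case True
      then have "f (Suc k) = 2" using s by simp
      then show ?thesis using True gk kk u1 upper_eq_2[of f "Suc k" n] upper_end[of f k n]
          upper_run[of g k n] by simp
    next
      case F: False
      then have "f (Suc k) = 1" "f k = 1" using s kk by auto
      moreover have "upper n f (Suc k) = 0"
        using \<open>f (Suc k) = 1\<close> kk upper_end[of f "Suc k" n] by auto
      ultimately show ?thesis using gk kk upper_eq_2[of g k n] upper_run[of f k n] by simp
    qed
    \<comment> \<open>Downward induction: \<open>upper\<close> at \<open>i\<close> is determined by
      the weights at \<open>i\<close> and \<open>i + 1\<close> and by \<open>upper\<close> at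
      \<open>i + 1\<close>, so only \<open>k - 1\<close> and \<open>k - 2\<close> could notice the
      move.\<close>
    have below: "upper n g i = upper n f i" if "i < k" for i
      using that
    proof (induction "k - i" arbitrary: i rule: less_induct)
      case less
      consider "Suc i = k" | "Suc (Suc i) = k" | "Suc (Suc i) < k" using less.prems by linarith
      then show ?case
      proof cases
        case 1
        show ?thesis
        proof (cases "f i = 0")
          case True
          then have "g i = 0" using 1 unfolding g_def move_def by auto
          then show ?thesis using True upper_end[of f i n] upper_end[of g i n] by simp
        next
          case False
          then have i: "1 \<le> i" "i < n" "f i \<le> 2" "f k \<le> 2" "g k \<le> 2"
            using path_cover_outside[OF pc, of i] kk 1 le by auto
          have e: "2 \<le> f i + f k" using path_cover_edge[OF pc i(1,2)] 1 by simp
          have gi: "g i = (if i = 1 \<or> 2 < f (i - 1) + f i then f i - 1 else f i)"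
            using 1 False unfolding g_def move_def by auto
          have t: "(1 < i \<and> f (i - 1) + f i = 2) \<or> f i + f k = 2"
            using tight_coverD[OF f, of i] False 1 by auto
          show ?thesis
          proof (cases "f k = 0")
            case True
            then have fi: "f i = 2" using e i by simp
            have "f (Suc k) = 2" using s True by simp
            then have "upper n g k = 0" using u0 True upper_end[of f k n] by simp
            have "upper n g i = 1"
            proof (cases "g i = 2")
              case True then show ?thesis by (rule upper_eq_2)
            next
              case F: False
              then have "g i = 1" using gi fi by (auto split: if_splits)
              then show ?thesis using upper_run[of g i n] i 1 gk True \<open>upper n g k = 0\<close> by simp
            qed
            then show ?thesis using upper_eq_2[of f i n] fi by simp
          next
            case F: False
            then have fk: "f k = 1" "f (Suc k) = 1" using s kk by auto
            then have uk: "upper n f (Suc k) = 0" using kk upper_end[of f "Suc k" n] by auto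
            then have uk': "upper n f k = 1" using upper_run[of f k n] fk kk by simp
            consider "f i = 1" | "f i = 2" using i False by linarith
            then show ?thesis
            proof cases
              case f1: 1
              then have "upper n f i = 0" using upper_run[of f i n] fk i 1 uk' by simp
              moreover have "upper n g i = g i div 2"
                using upper_end[of g i n] 1 gk fk by auto
              moreover have "g i \<le> 1" using gi f1 by (auto split: if_splits)
              ultimately show ?thesis by simp
            next
              case f2: 2
              then have "g i = 2" using t fk gi by auto
              then show ?thesis using f2 by (simp add: upper_eq_2)
            qed
          qed
        qed
      next
        case 2
        have IH: "upper n g (Suc i) = upper n f (Suc i)" using less.hyps[of "Suc i"] less.prems 2 by simp
        have gi: "g i = f i" using 2 unfolding g_def move_def by auto
        show ?thesis
        proof (cases "g (Suc i) = f (Suc i)")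
          case True then show ?thesis using IH gi by (simp add: upper.simps[of n _ i])
        next
          case F: False
          then have g1: "0 < f (Suc i)" "Suc i = 1 \<or> 2 < f i + f (Suc i)" "g (Suc i) = f (Suc i) - 1"
            using 2 unfolding g_def move_def by (auto split: if_splits)
          show ?thesis
          \<comment> \<open>If \<open>f i = 1\<close>, then \<open>k - 1\<close> drops from 2 to 1
            and \<open>i\<close> stops being the end of a run. Since \<open>upper\<close> still
            gives 1 to \<open>k - 1\<close>, it still gives 0 to \<open>i\<close>.\<close>
          proof (cases "f i = 1")
            case True
            then have "1 \<le> i" using path_cover_outside[OF pc, of i] by auto
            then have f2: "f (Suc i) = 2" using g1 True le(1)[of "Suc i"] by auto
            then have "upper n g (Suc i) = 1" using IH by (simp add: upper_eq_2)
            then show ?thesis using gi True f2 g1 upper_end[of f i n] upper_run[of g i n] 2 kk by simp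
          next
            case False then show ?thesis using gi upper_end[of f i n] upper_end[of g i n] by auto
          qed
        qed
      next
        case 3
        have "upper n g (Suc i) = upper n f (Suc i)" using less.hyps[of "Suc i"] less.prems 3 by simp
        moreover have "g i = f i" "g (Suc i) = f (Suc i)" using 3 unfolding g_def move_def by auto
        ultimately show ?thesis by (simp add: upper.simps[of n _ i])
      qed
    qed
    have u: "upper n g = upper n f"
    proof
      fix i
      consider "i < k" | "i = k" | "i = Suc k" | "i \<ge> Suc (Suc k)" by linarith
      then show "upper n g i = upper n f i" using below u0 u1 uabove by cases auto
    qed
    have "revlex_gt (lower n g) (lower n f)" unfolding revlex_gt_def
    proof (intro exI[of _ "Suc k"] conjI allI impI)
      show "lower n g (Suc k) < lower n f (Suc k)"
        using upper_add_lower[of f "Suc k" n, OF le(1)] upper_add_lower[of g "Suc k" n, OF le(2)] u1 gk kk(3)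
        by simp
      show "lower n g p = lower n f p" if "Suc k < p" for p
        using that u above[of p] unfolding lower_def by simp
    qed
    with u show ?thesis unfolding g_def by simp
  qed
qed

text \<open>This is the converse of the exchange: a generator that precedes \<open>f\<close> must
  exceed \<open>f\<close> at some movable vertex. Both comparisons below look at the last difference
  and exclude the case in which \<open>f\<close> is the larger one there.\<close>

lemma no_move_imp_less:
  assumes f: "tight_cover 2 n f" and g: "tight_cover 2 n g"
    and le: "\<And>k. k \<in> movable n f \<Longrightarrow> g k \<le> f k"
  shows "g = f \<or> revlex_gt (upper n f) (upper n g) \<or>
    upper n f = upper n g \<and> revlex_gt (lower n f) (lower n g)"
proof -
  note pf = tight_cover_imp_path_cover[OF f] and pg = tight_cover_imp_path_cover[OF g]
  note lef = tight_cover_le[OF f] and leg = tight_cover_le[OF g]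
  \<comment> \<open>If \<open>j > 1\<close> has positive weight, then \<open>j - 1\<close> is
    movable: the left edge has weight 2 in \<open>f\<close> and at least 2 in \<open>g\<close>,
    while \<open>g\<close> is no larger at \<open>j - 1\<close>. The vertex 1 has no left edge, so
    positive weight there would contradict tightness.\<close>
  have loose: "f j \<le> g j" if "j = n \<or> 2 < f j + f (Suc j)" for j
  proof (cases "1 < j \<and> j \<le> n \<and> 0 < f j")
    case True
    then have m: "j - 1 \<in> movable n f" using that unfolding movable_def by auto
    have "f (j - 1) + f j = 2" using movable_sum[OF f m] True by simp
    moreover have "2 \<le> g (j - 1) + g j" using path_cover_edge[OF pg, of "j - 1"] True by auto
    ultimately show ?thesis using le[OF m] by linarith
  next
    case False
    show ?thesis
    proof (cases "f j = 0")
      case False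
      with \<open>\<not> (1 < j \<and> j \<le> n \<and> 0 < f j)\<close> have "j = 1"
        using path_cover_outside[OF pf, of j] by linarith
      then show ?thesis using tight_coverD[OF f, of j] False that by auto
    qed simp
  qed
  have outside: "f p = 0" "g p = 0" "upper n f p = 0" "upper n g p = 0" if "p > n" for p
  proof -
    show fg: "f p = 0" "g p = 0"
      using that path_cover_outside[OF pf, of p] path_cover_outside[OF pg, of p] by auto
    show "upper n f p = 0" "upper n g p = 0"
      using upper_le[of f p n] upper_le[of g p n] fg by auto
  qed
  show ?thesis
  proof (cases "upper n f = upper n g")
    case u: True
    show ?thesis
    proof (cases "g = f")
      case False
      then obtain q where q: "g q \<noteq> f q" "\<And>p. p > q \<Longrightarrow> g p = f p"
        using largest_difference[of g f n] outside by metis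
      \<comment> \<open>Either \<open>loose\<close> applies, or the right edge has weight 2 in
        \<open>f\<close>; then the cover condition for \<open>g\<close> suffices, as the two agree
        at \<open>q + 1\<close>.\<close>
      have "f q \<le> g q"
      proof (cases "q = n \<or> 2 < f q + f (Suc q) \<or> f q = 0")
        case True then show ?thesis using loose by auto
      next
        case False
        then have "1 \<le> q" "q < n" using path_cover_outside[OF pf, of q] by linarith+
        then show ?thesis using path_cover_edge[OF pg, of q] q(2)[of "Suc q"] False by simp
      qed
      with q(1) have "f q < g q" by simp
      then have "revlex_gt (lower n f) (lower n g)"
        unfolding revlex_gt_def
        using upper_add_lower[of f q n, OF lef] upper_add_lower[of g q n, OF leg] u q(2)
        by (intro exI[of _ q]) (auto simp: lower_def)
      then show ?thesis using u by simp
    qed simp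
  next
    case False
    then obtain q where q: "upper n f q \<noteq> upper n g q" "\<And>p. p > q \<Longrightarrow> upper n f p = upper n g p"
      using largest_difference[of "upper n f" "upper n g" n] outside by metis
    have "upper n f q < upper n g q"
    proof (rule ccontr)
      assume "\<not> ?thesis"
      with q(1) have uq: "upper n f q = 1" "upper n g q = 0"
        using upper_le[of f q n, OF lef] by auto
      then have fq: "0 < f q" using upper_le[of f q n, OF lef] by simp
      then have q1: "1 \<le> q" "q \<le> n" using path_cover_outside[OF pf, of q] by auto
      \<comment> \<open>With value 0 at \<open>q\<close>, \<open>upper n g\<close> must be 1 at
        \<open>q + 1\<close>, and \<open>upper n f\<close> agrees with it there. A run of
        \<open>f\<close> through \<open>q\<close> and \<open>q + 1\<close> would then give 0 at
        \<open>q\<close>, so \<open>f q = 2\<close> and \<open>loose\<close> forces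
        \<open>g q = 2\<close>, against \<open>upper n g q = 0\<close>.\<close>
      have "q = n \<or> upper n f (Suc q) = 1"
      proof (cases "q = n")
        case False
        then have "1 \<le> upper n g q + upper n g (Suc q)"
          using path_cover_edge[OF upper_cover(1)[OF pg leg], of q] q1 by simp
        then show ?thesis using uq q(2)[of "Suc q"] upper_le[of f "Suc q" n, OF lef] by simp
      qed simp
      then have "f q = 2" "q = n \<or> 1 \<le> f (Suc q)"
        using uq(1) upper_run[of f q n] upper_end[of f q n] lef[of q] upper_le[of f "Suc q" n, OF lef] q1
        by (cases "f q = 1 \<and> q < n \<and> f (Suc q) = 1"; auto)+
      then have "2 \<le> g q" using loose[of q] by auto
      then have "g q = 2" using leg[of q] by simp
      then show False using uq(2) by (simp add: upper_eq_2)
    qed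
    then have "revlex_gt (upper n f) (upper n g)" unfolding revlex_gt_def using q(2) by blast
    then show ?thesis by simp
  qed
qed

subsection \<open>The rooted list\<close>

lemma lookup_var: "Poly_Mapping.lookup (var i) j = (if i = j then 1 else 0)"
  unfolding var_def by (simp add: lookup_single when_def)

lemma lookup_Abs_cover:
  assumes "path_cover d n f"
  shows "Poly_Mapping.lookup (Abs_poly_mapping f) = f"
proof -
  have "{i. f i \<noteq> 0} \<subseteq> {1..n}" using assms unfolding path_cover_def by auto
  then have "finite {i. f i \<noteq> 0}" by (rule finite_subset) simp
  then show ?thesis by (simp add: Abs_poly_mapping_inverse)
qed

text \<open>In each block of the recursion the new factor uses only vertices beyond the shorter path
  and covers every edge outside it.\<close>

lemma rooted_cover:
  "u \<in> set (rooted m) \<Longrightarrow> path_cover 1 m (Poly_Mapping.lookup u) \<and> (\<forall>i. Poly_Mapping.lookup u i \<le> 1)"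
proof (induction m arbitrary: u rule: rooted.induct)
  case (6 k)
  then consider v where "v \<in> set (rooted (k + 3))" "u = var (k + 4) + v"
    | v where "v \<in> set (rooted (k + 2))" "u = var (k + 5) + var (k + 3) + v" by auto
  then show ?case
  proof cases
    case 1
    note IH = "6.IH"(1)[OF 1(1)]
    have z: "Poly_Mapping.lookup v i = 0" if "i > k + 3" for i
      using path_cover_outside[OF conjunct1[OF IH], of i] that by simp
    have s: "Poly_Mapping.lookup v i = 0 \<or> 1 \<le> i \<and> i \<le> k + 3" for i
      using path_cover_outside[OF conjunct1[OF IH], of i] by blast
    have e: "1 \<le> Poly_Mapping.lookup v i + Poly_Mapping.lookup v (Suc i)" if "1 \<le> i" "i < k + 3" for i
      using path_cover_edge[OF conjunct1[OF IH] that] .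
    have "1 \<le> Poly_Mapping.lookup u i + Poly_Mapping.lookup u (Suc i)" if i: "1 \<le> i" "i < k + 5" for i
    proof -
      consider "i < k + 3" | "i = k + 3" | "i = k + 4" using i by linarith
      then show ?thesis using i e[of i] unfolding 1(2) by cases (auto simp: lookup_add lookup_var)
    qed
    moreover have "1 \<le> i \<and> i \<le> k + 5" if "0 < Poly_Mapping.lookup u i" for i
      using that s[of i] unfolding 1(2) by (auto simp: lookup_add lookup_var split: if_splits)
    moreover have "Poly_Mapping.lookup u i \<le> 1" for i
      using IH z[of i] unfolding 1(2) by (auto simp: lookup_add lookup_var)
    ultimately show ?thesis unfolding path_cover_def by (auto simp: eval_nat_numeral)
  next
    case 2
    note IH = "6.IH"(2)[OF 2(1)]
    have z: "Poly_Mapping.lookup v i = 0" if "i > k + 2" for i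
      using path_cover_outside[OF conjunct1[OF IH], of i] that by simp
    have s: "Poly_Mapping.lookup v i = 0 \<or> 1 \<le> i \<and> i \<le> k + 2" for i
      using path_cover_outside[OF conjunct1[OF IH], of i] by blast
    have e: "1 \<le> Poly_Mapping.lookup v i + Poly_Mapping.lookup v (Suc i)" if "1 \<le> i" "i < k + 2" for i
      using path_cover_edge[OF conjunct1[OF IH] that] .
    have "1 \<le> Poly_Mapping.lookup u i + Poly_Mapping.lookup u (Suc i)" if i: "1 \<le> i" "i < k + 5" for i
    proof -
      consider "i < k + 2" | "i = k + 2" | "i = k + 3" | "i = k + 4" using i by linarith
      then show ?thesis using i e[of i] unfolding 2(2) by cases (auto simp: lookup_add lookup_var)
    qed
    moreover have "1 \<le> i \<and> i \<le> k + 5" if "0 < Poly_Mapping.lookup u i" for i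
      using that s[of i] unfolding 2(2) by (auto simp: lookup_add lookup_var split: if_splits)
    moreover have "Poly_Mapping.lookup u i \<le> 1" for i
      using IH z[of i] unfolding 2(2) by (auto simp: lookup_add lookup_var)
    ultimately show ?thesis unfolding path_cover_def by (auto simp: eval_nat_numeral)
  qed
qed (auto simp: path_cover_def lookup_add lookup_var less_Suc_eq split: if_splits)

lemma revlex_gt_add_left:
  "revlex_gt (Poly_Mapping.lookup (w + u)) (Poly_Mapping.lookup (w + v)) \<longleftrightarrow>
    revlex_gt (Poly_Mapping.lookup u) (Poly_Mapping.lookup v)"
  unfolding revlex_gt_def by (simp add: lookup_add)

text \<open>Covers in the first block of the recursion avoid the last vertex and those in the second
  contain it, so the last exponent separates the blocks. Within a block the common factor
  cancels.\<close>

lemma rooted_sorted: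
  "sorted_wrt (\<lambda>u v. revlex_gt (Poly_Mapping.lookup u) (Poly_Mapping.lookup v)) (rooted m)"
proof (induction m rule: rooted.induct)
  case 3
  have "revlex_gt (Poly_Mapping.lookup (var 1)) (Poly_Mapping.lookup (var 2))"
    unfolding revlex_gt_def by (rule exI[of _ 2]) (auto simp: lookup_var)
  then show ?case by simp
next
  case 4
  have "revlex_gt (Poly_Mapping.lookup (var 2)) (Poly_Mapping.lookup (var 1 + var 3))"
    unfolding revlex_gt_def by (rule exI[of _ 3]) (auto simp: lookup_var lookup_add)
  then show ?case by simp
next
  case 5
  have "revlex_gt (Poly_Mapping.lookup (var 1 + var 3)) (Poly_Mapping.lookup (var 2 + var 3))"
    unfolding revlex_gt_def by (rule exI[of _ 2]) (auto simp: lookup_var lookup_add)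
  moreover have "revlex_gt (Poly_Mapping.lookup (var 1 + var 3)) (Poly_Mapping.lookup (var 2 + var 4))"
    unfolding revlex_gt_def by (rule exI[of _ 4]) (auto simp: lookup_var lookup_add)
  moreover have "revlex_gt (Poly_Mapping.lookup (var 2 + var 3)) (Poly_Mapping.lookup (var 2 + var 4))"
    unfolding revlex_gt_def by (rule exI[of _ 4]) (auto simp: lookup_var lookup_add)
  ultimately show ?case by simp
next
  case (6 k)
  have "revlex_gt (Poly_Mapping.lookup (var (k + 4) + u)) (Poly_Mapping.lookup (var (k + 5) + var (k + 3) + v))"
    if u: "u \<in> set (rooted (k + 3))" and v: "v \<in> set (rooted (k + 2))" for u v
  proof -
    have "Poly_Mapping.lookup u p = 0" "Poly_Mapping.lookup v p = 0" if "p > k + 4" for p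
      using that path_cover_outside[OF conjunct1[OF rooted_cover[OF u]], of p]
        path_cover_outside[OF conjunct1[OF rooted_cover[OF v]], of p] by auto
    then show ?thesis
      unfolding revlex_gt_def by (intro exI[of _ "k + 5"]) (auto simp: lookup_add lookup_var)
  qed
  then show ?case using 6 by (auto simp: sorted_wrt_append sorted_wrt_map revlex_gt_add_left)
qed simp_all

text \<open>If the last vertex is absent, its neighbour is forced; if it is present, tightness
  excludes its neighbour and so forces the vertex before that. Deleting the forced factor leaves a
  tight cover of the shorter path. For paths on 2, 3 and 4 vertices the inequalities leave only the
  listed covers.\<close>

lemma rooted_complete:
  "2 \<le> m \<Longrightarrow> tight_cover 1 m (Poly_Mapping.lookup u) \<Longrightarrow> u \<in> set (rooted m)"
proof (induction m arbitrary: u rule: rooted.induct)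
  case 3
  have t: "tight_cover 1 2 (Poly_Mapping.lookup u)" using 3 by (simp add: eval_nat_numeral)
  note p = tight_cover_imp_path_cover[OF t]
  have l: "Poly_Mapping.lookup u i \<le> 1" for i by (rule tight_cover_le[OF t])
  have z: "Poly_Mapping.lookup u i = 0" if "i \<noteq> 1" "i \<noteq> 2" for i
    using path_cover_outside[OF p, of i] that by (cases "i = 0") auto
  have e: "Poly_Mapping.lookup u 1 + Poly_Mapping.lookup u 2 = 1"
    using path_cover_edge[OF p, of 1] tight_coverD[OF t, of 1] tight_coverD[OF t, of 2]
    by (cases "Poly_Mapping.lookup u 1 = 0") (auto simp: numeral_2_eq_2)
  then consider "Poly_Mapping.lookup u 1 = 1" "Poly_Mapping.lookup u 2 = 0"
    | "Poly_Mapping.lookup u 1 = 0" "Poly_Mapping.lookup u 2 = 1" by linarith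
  then have "u = var 1 \<or> u = var 2"
  proof cases
    case 1
    then have "u = var 1" by (intro poly_mapping_eqI) (metis lookup_var z)
    then show ?thesis ..
  next
    case 2
    then have "u = var 2" by (intro poly_mapping_eqI) (metis lookup_var z)
    then show ?thesis ..
  qed
  then show ?case by auto
next
  case 4
  have t: "tight_cover 1 3 (Poly_Mapping.lookup u)" using 4 by (simp add: eval_nat_numeral)
  note p = tight_cover_imp_path_cover[OF t]
  have l: "Poly_Mapping.lookup u i \<le> 1" for i by (rule tight_cover_le[OF t])
  have z: "Poly_Mapping.lookup u i = 0" if "i \<noteq> 1" "i \<noteq> 2" "i \<noteq> 3" for i
    using path_cover_outside[OF p, of i] that by linarith
  have e: "1 \<le> Poly_Mapping.lookup u 1 + Poly_Mapping.lookup u 2"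
    "1 \<le> Poly_Mapping.lookup u 2 + Poly_Mapping.lookup u 3"
    using path_cover_edge[OF p, of 1] path_cover_edge[OF p, of 2] by (auto simp: numeral_2_eq_2 numeral_3_eq_3)
  have c: "0 < Poly_Mapping.lookup u 1 \<Longrightarrow> Poly_Mapping.lookup u 1 + Poly_Mapping.lookup u 2 = 1"
    "0 < Poly_Mapping.lookup u 3 \<Longrightarrow> Poly_Mapping.lookup u 2 + Poly_Mapping.lookup u 3 = 1"
    using tight_coverD[OF t, of 1] tight_coverD[OF t, of 3] by (auto simp: numeral_2_eq_2)
  consider "Poly_Mapping.lookup u 1 = 1" "Poly_Mapping.lookup u 2 = 0" "Poly_Mapping.lookup u 3 = 1"
    | "Poly_Mapping.lookup u 1 = 0" "Poly_Mapping.lookup u 2 = 1" "Poly_Mapping.lookup u 3 = 0"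
    using e c l[of 1] l[of 2] l[of 3] by linarith
  then have "u = var 1 + var 3 \<or> u = var 2"
  proof cases
    case 1
    then have "Poly_Mapping.lookup u i = Poly_Mapping.lookup (var 1 + var 3) i" for i
      using z[of i] by (cases "i = 1"; cases "i = 2"; cases "i = 3") (auto simp: lookup_add lookup_var)
    then show ?thesis by (blast intro: poly_mapping_eqI)
  next
    case 2
    then have "Poly_Mapping.lookup u i = Poly_Mapping.lookup (var 2) i" for i
      using z[of i] by (cases "i = 1"; cases "i = 2"; cases "i = 3") (auto simp: lookup_add lookup_var)
    then show ?thesis by (blast intro: poly_mapping_eqI)
  qed
  then show ?case by auto
next
  case 5
  have t: "tight_cover 1 4 (Poly_Mapping.lookup u)" using 5 by (simp add: eval_nat_numeral)
  note p = tight_cover_imp_path_cover[OF t]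
  have l: "Poly_Mapping.lookup u i \<le> 1" for i by (rule tight_cover_le[OF t])
  have z: "Poly_Mapping.lookup u i = 0" if "i \<noteq> 1" "i \<noteq> 2" "i \<noteq> 3" "i \<noteq> 4" for i
    using path_cover_outside[OF p, of i] that by linarith
  have e: "1 \<le> Poly_Mapping.lookup u 1 + Poly_Mapping.lookup u 2"
    "1 \<le> Poly_Mapping.lookup u 2 + Poly_Mapping.lookup u 3"
    "1 \<le> Poly_Mapping.lookup u 3 + Poly_Mapping.lookup u 4"
    using path_cover_edge[OF p, of 1] path_cover_edge[OF p, of 2] path_cover_edge[OF p, of 3]
    by (auto simp: eval_nat_numeral)
  have c: "0 < Poly_Mapping.lookup u 1 \<Longrightarrow> Poly_Mapping.lookup u 1 + Poly_Mapping.lookup u 2 = 1"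
    "0 < Poly_Mapping.lookup u 4 \<Longrightarrow> Poly_Mapping.lookup u 3 + Poly_Mapping.lookup u 4 = 1"
    "0 < Poly_Mapping.lookup u 2 \<Longrightarrow> Poly_Mapping.lookup u 1 + Poly_Mapping.lookup u 2 = 1 \<or>
       Poly_Mapping.lookup u 2 + Poly_Mapping.lookup u 3 = 1"
    using tight_coverD[OF t, of 1] tight_coverD[OF t, of 4] tight_coverD[OF t, of 2]
    by (auto simp: eval_nat_numeral)
  consider "Poly_Mapping.lookup u 1 = 1" "Poly_Mapping.lookup u 2 = 0" "Poly_Mapping.lookup u 3 = 1" "Poly_Mapping.lookup u 4 = 0"
    | "Poly_Mapping.lookup u 1 = 0" "Poly_Mapping.lookup u 2 = 1" "Poly_Mapping.lookup u 3 = 1" "Poly_Mapping.lookup u 4 = 0"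
    | "Poly_Mapping.lookup u 1 = 0" "Poly_Mapping.lookup u 2 = 1" "Poly_Mapping.lookup u 3 = 0" "Poly_Mapping.lookup u 4 = 1"
    using e c l[of 1] l[of 2] l[of 3] l[of 4] by linarith
  then have "u = var 1 + var 3 \<or> u = var 2 + var 3 \<or> u = var 2 + var 4"
  proof cases
    case 1
    then have "Poly_Mapping.lookup u i = Poly_Mapping.lookup (var 1 + var 3) i" for i
      using z[of i] by (cases "i = 1"; cases "i = 2"; cases "i = 3"; cases "i = 4") (auto simp: lookup_add lookup_var)
    then show ?thesis by (blast intro: poly_mapping_eqI)
  next
    case 2
    then have "Poly_Mapping.lookup u i = Poly_Mapping.lookup (var 2 + var 3) i" for i
      using z[of i] by (cases "i = 1"; cases "i = 2"; cases "i = 3"; cases "i = 4") (auto simp: lookup_add lookup_var)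
    then show ?thesis by (blast intro: poly_mapping_eqI)
  next
    case 3
    then have "Poly_Mapping.lookup u i = Poly_Mapping.lookup (var 2 + var 4) i" for i
      using z[of i] by (cases "i = 1"; cases "i = 2"; cases "i = 3"; cases "i = 4") (auto simp: lookup_add lookup_var)
    then show ?thesis by (blast intro: poly_mapping_eqI)
  qed
  then show ?case by auto
next
  case (6 k)
  have t: "tight_cover 1 (k + 5) (Poly_Mapping.lookup u)" using 6 by (simp add: eval_nat_numeral)
  note p = tight_cover_imp_path_cover[OF t]
  have l: "Poly_Mapping.lookup u i \<le> 1" for i by (rule tight_cover_le[OF t])
  have e: "1 \<le> Poly_Mapping.lookup u i + Poly_Mapping.lookup u (Suc i)" if "1 \<le> i" "i < k + 5" for i
    by (rule path_cover_edge[OF p that])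
  have e4: "1 \<le> Poly_Mapping.lookup u (k + 4) + Poly_Mapping.lookup u (k + 5)"
    using e[of "k + 4"] by (simp add: eval_nat_numeral)
  have e3: "1 \<le> Poly_Mapping.lookup u (k + 3) + Poly_Mapping.lookup u (k + 4)"
    using e[of "k + 3"] by (simp add: eval_nat_numeral)
  have supp: "1 \<le> i \<and> i \<le> k + 5" if "0 < Poly_Mapping.lookup u i" for i
    using p that unfolding path_cover_def by blast
  show ?case
  proof (cases "Poly_Mapping.lookup u (k + 5) = 0")
    case True
    then have u4: "Poly_Mapping.lookup u (k + 4) = 1" using e4 l[of "k + 4"] by simp
    define v where "v = u - var (k + 4)"
    have v: "Poly_Mapping.lookup v i = (if i = k + 4 then 0 else Poly_Mapping.lookup u i)" for i
      unfolding v_def using u4 by (simp add: lookup_minus lookup_var)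
    have "u = var (k + 4) + v"
      using u4 by (intro poly_mapping_eqI) (simp add: lookup_add lookup_var v)
    moreover have "tight_cover 1 (k + 3) (Poly_Mapping.lookup v)"
      unfolding tight_cover_def path_cover_def
    proof (intro conjI allI impI)
      fix i assume pos: "0 < Poly_Mapping.lookup v i"
      have ui: "0 < Poly_Mapping.lookup u i" using pos v[of i] by (simp split: if_splits)
      have "i \<noteq> k + 4" "i \<noteq> k + 5" using pos True v[of i] by (auto split: if_splits)
      then show i: "1 \<le> i" "i \<le> k + 3" using supp[OF ui] by auto
      \<comment> \<open>Both ends of this edge lie in the cover, so it cannot be the tight edge of
        \<open>k + 3\<close>; the tight edge lies inside the shorter path.\<close>
      have far: "Poly_Mapping.lookup u i + Poly_Mapping.lookup u (Suc i) \<noteq> 1" if "i = k + 3"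
        using that u4 ui by (simp add: eval_nat_numeral)
      have vi: "Poly_Mapping.lookup v (i - 1) = Poly_Mapping.lookup u (i - 1)"
        "Poly_Mapping.lookup v i = Poly_Mapping.lookup u i"
        "i < k + 3 \<Longrightarrow> Poly_Mapping.lookup v (Suc i) = Poly_Mapping.lookup u (Suc i)"
        using i by (auto simp: v)
      from tight_coverD[OF t ui]
      show "1 < i \<and> Poly_Mapping.lookup v (i - 1) + Poly_Mapping.lookup v i = 1 \<or>
            i < k + 3 \<and> Poly_Mapping.lookup v i + Poly_Mapping.lookup v (Suc i) = 1"
        using vi far i(2) by (cases "i = k + 3") auto
    next
      fix i assume "1 \<le> i \<and> i < k + 3"
      then show "1 \<le> Poly_Mapping.lookup v i + Poly_Mapping.lookup v (Suc i)"
        using e[of i] by (auto simp: v)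
    qed
    then have "v \<in> set (rooted (k + 3))" using "6.IH"(1) by simp
    ultimately show ?thesis by simp
  next
    case False
    then have u5: "Poly_Mapping.lookup u (k + 5) = 1" using l[of "k + 5"] by simp
    have u4: "Poly_Mapping.lookup u (k + 4) = 0"
      using tight_coverD[OF t, of "k + 5"] u5 by (auto simp: eval_nat_numeral)
    then have u3: "Poly_Mapping.lookup u (k + 3) = 1" using e3 l[of "k + 3"] by simp
    define v where "v = u - (var (k + 5) + var (k + 3))"
    have v: "Poly_Mapping.lookup v i = (if i = k + 5 \<or> i = k + 3 then 0 else Poly_Mapping.lookup u i)" for i
      unfolding v_def using u5 u3 by (simp add: lookup_minus lookup_add lookup_var)
    have "u = var (k + 5) + var (k + 3) + v"
      using u5 u3 by (intro poly_mapping_eqI) (simp add: lookup_add lookup_var v)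
    moreover have "tight_cover 1 (k + 2) (Poly_Mapping.lookup v)"
      unfolding tight_cover_def path_cover_def
    proof (intro conjI allI impI)
      fix i assume pos: "0 < Poly_Mapping.lookup v i"
      have ui: "0 < Poly_Mapping.lookup u i" using pos v[of i] by (simp split: if_splits)
      have "i \<noteq> k + 3" "i \<noteq> k + 4" "i \<noteq> k + 5" using pos u4 v[of i] by (auto split: if_splits)
      then show i: "1 \<le> i" "i \<le> k + 2" using supp[OF ui] by auto
      have far: "Poly_Mapping.lookup u i + Poly_Mapping.lookup u (Suc i) \<noteq> 1" if "i = k + 2"
        using that u3 ui by (simp add: eval_nat_numeral)
      have vi: "Poly_Mapping.lookup v (i - 1) = Poly_Mapping.lookup u (i - 1)"
        "Poly_Mapping.lookup v i = Poly_Mapping.lookup u i"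
        "i < k + 2 \<Longrightarrow> Poly_Mapping.lookup v (Suc i) = Poly_Mapping.lookup u (Suc i)"
        using i by (auto simp: v)
      from tight_coverD[OF t ui]
      show "1 < i \<and> Poly_Mapping.lookup v (i - 1) + Poly_Mapping.lookup v i = 1 \<or>
            i < k + 2 \<and> Poly_Mapping.lookup v i + Poly_Mapping.lookup v (Suc i) = 1"
        using vi far i(2) by (cases "i = k + 2") auto
    next
      fix i assume "1 \<le> i \<and> i < k + 2"
      then show "1 \<le> Poly_Mapping.lookup v i + Poly_Mapping.lookup v (Suc i)"
        using e[of i] by (auto simp: v)
    qed
    then have "v \<in> set (rooted (k + 2))" using "6.IH"(2) by simp
    ultimately show ?thesis by simp
  qed
qed simp_all

text \<open>Asymmetry of \<open>revlex_gt\<close> turns comparison of covers into comparison of list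
  positions, on which exponent vectors depend.\<close>

lemma rooted_nth_less:
  assumes "i < length (rooted m)" "j < length (rooted m)"
    and gt: "revlex_gt (Poly_Mapping.lookup (rooted m ! i)) (Poly_Mapping.lookup (rooted m ! j))"
  shows "i < j"
proof (rule ccontr)
  assume "\<not> i < j"
  then consider "i = j" | "j < i" by linarith
  then show False
  proof cases
    case 1 then show False using gt unfolding revlex_gt_def by auto
  next
    case 2
    then have "revlex_gt (Poly_Mapping.lookup (rooted m ! j)) (Poly_Mapping.lookup (rooted m ! i))"
      using rooted_sorted[of m] assms(1) by (auto dest: sorted_wrt_nth_less)
    then show False using revlex_gt_asym[OF gt] by simp
  qed
qed

lemma rooted_nth_inject:
  assumes "i < length (rooted m)" "j < length (rooted m)" "rooted m ! i = rooted m ! j"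
  shows "i = j"
proof (rule ccontr)
  assume "i \<noteq> j"
  then have "revlex_gt (Poly_Mapping.lookup (rooted m ! i)) (Poly_Mapping.lookup (rooted m ! i))"
    using rooted_sorted[of m] assms sorted_wrt_nth_less by (metis linorder_neqE_nat)
  then show False unfolding revlex_gt_def by auto
qed

subsection \<open>Maximal expressions\<close>

text \<open>The sum of two unit vectors, that is, the exponent vector of a product of two
  generators; \<open>i = j\<close> yields the entry 2 of a square.\<close>

definition pair_vec :: "nat \<Rightarrow> nat \<Rightarrow> nat \<Rightarrow> nat list" where
  "pair_vec L i j = map (\<lambda>k. of_bool (k = i) + of_bool (k = j)) [0..<L]"

lemma length_pair_vec [simp]: "length (pair_vec L i j) = L"
  unfolding pair_vec_def by simp

lemma nth_pair_vec [simp]: "k < L \<Longrightarrow> pair_vec L i j ! k = of_bool (k = i) + of_bool (k = j)"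
  unfolding pair_vec_def by simp

lemma sum_list_eq_0_nth: "sum_list (a :: nat list) = 0 \<Longrightarrow> k < length a \<Longrightarrow> a ! k = 0"
  using member_le_sum_list[of "a ! k" a] by simp

lemma sum_list_eq_1_nth:
  "sum_list (a :: nat list) = 1 \<Longrightarrow> \<exists>i < length a. \<forall>k < length a. a ! k = of_bool (k = i)"
proof (induction a)
  case (Cons x a)
  then consider "x = 0" "sum_list a = 1" | "x = 1" "sum_list a = 0" by fastforce
  then show ?case
  proof cases
    case 1
    with Cons obtain i where i: "i < length a" "\<forall>k < length a. a ! k = of_bool (k = i)" by auto
    show ?thesis by (rule exI[of _ "Suc i"]) (use i 1 in \<open>auto simp: nth_Cons split: nat.split\<close>)
  next
    case 2
    show ?thesis
      by (rule exI[of _ 0]) (use 2 sum_list_eq_0_nth[of a] in \<open>auto simp: nth_Cons split: nat.split\<close>)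
  qed
qed simp

lemma sum_list_eq_2_nth:
  "sum_list (a :: nat list) = 2 \<Longrightarrow>
    \<exists>i j. i \<le> j \<and> j < length a \<and> (\<forall>k < length a. a ! k = of_bool (k = i) + of_bool (k = j))"
proof (induction a)
  case (Cons x a)
  then consider "x = 0" "sum_list a = 2" | "x = 1" "sum_list a = 1" | "x = 2" "sum_list a = 0"
    by fastforce
  then show ?case
  proof cases
    case 1
    with Cons obtain i j where i: "i \<le> j" "j < length a"
        "\<forall>k < length a. a ! k = of_bool (k = i) + of_bool (k = j)" by auto
    show ?thesis
      by (rule exI[of _ "Suc i"], rule exI[of _ "Suc j"]) (use i 1 in \<open>auto simp: nth_Cons split: nat.split\<close>)
  next
    case 2
    from sum_list_eq_1_nth[OF 2(2)] obtain j where
      j: "j < length a" "\<forall>k < length a. a ! k = of_bool (k = j)" by auto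
    show ?thesis
      by (rule exI[of _ 0], rule exI[of _ "Suc j"]) (use j 2 in \<open>auto simp: nth_Cons split: nat.split\<close>)
  next
    case 3
    show ?thesis
      by (rule exI[of _ 0], rule exI[of _ 0])
        (use 3 sum_list_eq_0_nth[of a] in \<open>auto simp: nth_Cons split: nat.split\<close>)
  qed
qed simp

lemma sum_list_eq_2_pair_vec:
  assumes "sum_list (a :: nat list) = 2"
  obtains i j where "i \<le> j" "j < length a" "a = pair_vec (length a) i j"
  using sum_list_eq_2_nth[OF assms] by (metis nth_equalityI length_pair_vec nth_pair_vec)

lemma sum_list_pair_vec:
  assumes "i < L" "j < L"
  shows "sum_list (pair_vec L i j) = 2"
  using assms unfolding pair_vec_def
  by (simp add: interv_sum_list_conv_sum_set_nat sum.distrib of_bool_def)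

lemma expr_mon_pair_vec:
  assumes "i < length (rooted m)" "j < length (rooted m)"
  shows "expr_mon m (pair_vec (length (rooted m)) i j) = rooted m ! i + rooted m ! j"
proof -
  have "expr_mon m (pair_vec (length (rooted m)) i j) =
    (\<Sum>k<length (rooted m). (if k = i then rooted m ! k else 0) + (if k = j then rooted m ! k else 0))"
    unfolding expr_mon_def by (rule sum.cong) (auto simp: numeral_2_eq_2)
  then show ?thesis using assms by (simp add: sum.distrib)
qed

lemma lex_gt_asym: "lex_gt a b \<Longrightarrow> length a = length b \<Longrightarrow> \<not> lex_gt b a"
proof
  assume "lex_gt a b" "lex_gt b a"
  then obtain k l where k: "take k a = take k b" "a ! k > b ! k"
    and l: "take l b = take l a" "b ! l > a ! l" unfolding lex_gt_def by blast
  consider "k < l" | "k = l" | "l < k" by linarith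
  then show False
  proof cases
    case 1 then show False using l(1) k(2) nth_take[of k l a] nth_take[of k l b] by simp
  next
    case 2 then show False using k l by simp
  next
    case 3 then show False using k(1) l(2) nth_take[of l k a] nth_take[of l k b] by simp
  qed
qed

text \<open>With sorted indices the vectors first differ at \<open>i\<close> if
  \<open>i < i'\<close>, and at \<open>j\<close> otherwise. Smaller index pairs therefore give
  larger vectors.\<close>

lemma lex_gt_pair_vec:
  assumes "i \<le> j" "j < L" "i' \<le> j'" "j' < L" and lt: "i < i' \<or> i = i' \<and> j < j'"
  shows "lex_gt (pair_vec L i j) (pair_vec L i' j')"
proof (cases "i < i'")
  case True
  then show ?thesis unfolding lex_gt_def using assms
    by (intro exI[of _ i]) (auto intro!: nth_equalityI)
next
  case False
  then show ?thesis unfolding lex_gt_def using assms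
    by (intro exI[of _ j]) (auto intro!: nth_equalityI)
qed

text \<open>By \<open>upper_greatest\<close>, no first factor of an expression stands before
  \<open>upper\<close> in the rooted list, and the first factor determines the second. The canonical
  splitting is hence the lexicographically largest expression.\<close>

lemma max_expr_eq:
  assumes n: "2 \<le> n" and M: "tight_cover 2 n (Poly_Mapping.lookup M)"
  obtains i j where "i \<le> j" "j < length (rooted n)"
    "Poly_Mapping.lookup (rooted n ! i) = upper n (Poly_Mapping.lookup M)"
    "Poly_Mapping.lookup (rooted n ! j) = lower n (Poly_Mapping.lookup M)"
    "max_expr n M = pair_vec (length (rooted n)) i j"
proof -
  define f where "f = Poly_Mapping.lookup M"
  define L where "L = length (rooted n)"
  have f: "tight_cover 2 n f" using M unfolding f_def .
  note le = tight_cover_le[OF f] and pf = tight_cover_imp_path_cover[OF f]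
  note tu = tight_upper[OF f] and tl = tight_lower[OF f]
  note lu = lookup_Abs_cover[OF tight_cover_imp_path_cover[OF tu]]
    and ll = lookup_Abs_cover[OF tight_cover_imp_path_cover[OF tl]]
  have "Abs_poly_mapping (upper n f) \<in> set (rooted n)" using rooted_complete[OF n] lu tu by simp
  then obtain i where i: "i < L" "rooted n ! i = Abs_poly_mapping (upper n f)"
    unfolding L_def by (metis in_set_conv_nth)
  have "Abs_poly_mapping (lower n f) \<in> set (rooted n)" using rooted_complete[OF n] ll tl by simp
  then obtain j where j: "j < L" "rooted n ! j = Abs_poly_mapping (lower n f)"
    unfolding L_def by (metis in_set_conv_nth)
  have gr: "i \<le> i'" if g: "i' < L" "j' < L" and eq: "rooted n ! i' + rooted n ! j' = M" for i' j'
  proof -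
    have "rooted n ! i' \<in> set (rooted n)" "rooted n ! j' \<in> set (rooted n)" using g unfolding L_def by auto
    note c = rooted_cover[OF this(1)] rooted_cover[OF this(2)]
    have "Poly_Mapping.lookup (rooted n ! i') = upper n f \<or>
        revlex_gt (upper n f) (Poly_Mapping.lookup (rooted n ! i'))"
      by (rule upper_greatest[of _ _ "Poly_Mapping.lookup (rooted n ! j')"])
        (use c pf in \<open>auto simp: f_def eq[symmetric] lookup_add\<close>)
    then show ?thesis
    proof
      assume "Poly_Mapping.lookup (rooted n ! i') = upper n f"
      then have "rooted n ! i' = rooted n ! i"
        using lu i(2) by (metis poly_mapping_eqI)
      then show ?thesis using rooted_nth_inject[of i' n i] g i unfolding L_def by simp
    next
      assume "revlex_gt (upper n f) (Poly_Mapping.lookup (rooted n ! i'))"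
      then show ?thesis using rooted_nth_less[of i n i'] g i lu unfolding L_def by simp
    qed
  qed
  have M_eq: "rooted n ! i + rooted n ! j = M"
    by (rule poly_mapping_eqI) (simp add: lookup_add i j lu ll upper_add_lower le f_def[symmetric])
  \<comment> \<open>The swapped factorisation, with the lower factor first, is also subject to
    \<open>gr\<close>.\<close>
  have ij: "i \<le> j" using gr[of j i] i(1) j(1) M_eq by (simp add: add.commute)
  have in_e: "pair_vec L i j \<in> exprs n M"
    unfolding exprs_def using i j M_eq sum_list_pair_vec expr_mon_pair_vec[of i n j] by (simp add: L_def)
  have best: "lex_gt (pair_vec L i j) b" if b: "b \<in> exprs n M" "b \<noteq> pair_vec L i j" for b
  proof -
    have bl: "length b = L" "sum_list b = 2" "expr_mon n b = M" using b(1) unfolding exprs_def L_def by auto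
    obtain i' j' where b': "i' \<le> j'" "j' < L" "b = pair_vec L i' j'"
      using sum_list_eq_2_pair_vec[OF bl(2)] bl(1) by metis
    have eq: "rooted n ! i' + rooted n ! j' = M"
      using bl(3) b' expr_mon_pair_vec[of i' n j'] unfolding L_def by simp
    have "i \<le> i'" using gr[OF _ b'(2) eq] b' by simp
    moreover have "i \<noteq> i'"
    proof
      assume "i = i'"
      then have "rooted n ! j = rooted n ! j'" using eq M_eq by (metis add_left_cancel)
      then have "j = j'" using rooted_nth_inject[of j n j'] j b' unfolding L_def by simp
      then show False using b(2) b'(3) \<open>i = i'\<close> by simp
    qed
    ultimately show ?thesis unfolding b'(3) using lex_gt_pair_vec[OF ij j(1) b'(1,2)] by simp
  qed
  have "max_expr n M = pair_vec L i j"
    unfolding max_expr_def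
  proof (rule the_equality)
    fix a assume a: "a \<in> exprs n M \<and> (\<forall>b\<in>exprs n M. b \<noteq> a \<longrightarrow> lex_gt a b)"
    show "a = pair_vec L i j"
    proof (rule ccontr)
      assume ne: "a \<noteq> pair_vec L i j"
      then have "lex_gt a (pair_vec L i j)" "lex_gt (pair_vec L i j) a" using a in_e best by metis+
      moreover have "length a = L" using a unfolding exprs_def L_def by simp
      ultimately show False using lex_gt_asym[of a "pair_vec L i j"] by simp
    qed
  qed (use in_e best in auto)
  then show thesis using that[OF ij] i j lu ll unfolding L_def f_def by simp
qed

text \<open>Through the index pairs of maximal expressions, the rooted order becomes the comparison
  of \<open>upper\<close> followed by \<open>lower\<close>, the form produced by the exchange
  lemmas.\<close>

lemma rooted_gtI:
  assumes n: "2 \<le> n" and M: "tight_cover 2 n (Poly_Mapping.lookup M)"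
    and N: "tight_cover 2 n (Poly_Mapping.lookup N)"
    and gt: "revlex_gt (upper n (Poly_Mapping.lookup M)) (upper n (Poly_Mapping.lookup N)) \<or>
      upper n (Poly_Mapping.lookup M) = upper n (Poly_Mapping.lookup N) \<and>
      revlex_gt (lower n (Poly_Mapping.lookup M)) (lower n (Poly_Mapping.lookup N))"
  shows "rooted_gt n M N"
proof -
  obtain i j where i: "i \<le> j" "j < length (rooted n)"
    "Poly_Mapping.lookup (rooted n ! i) = upper n (Poly_Mapping.lookup M)"
    "Poly_Mapping.lookup (rooted n ! j) = lower n (Poly_Mapping.lookup M)"
    "max_expr n M = pair_vec (length (rooted n)) i j" using max_expr_eq[OF n M] .
  obtain i' j' where i': "i' \<le> j'" "j' < length (rooted n)"
    "Poly_Mapping.lookup (rooted n ! i') = upper n (Poly_Mapping.lookup N)"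
    "Poly_Mapping.lookup (rooted n ! j') = lower n (Poly_Mapping.lookup N)"
    "max_expr n N = pair_vec (length (rooted n)) i' j'" using max_expr_eq[OF n N] .
  from gt have "i < i' \<or> i = i' \<and> j < j'"
  proof
    assume "revlex_gt (upper n (Poly_Mapping.lookup M)) (upper n (Poly_Mapping.lookup N))"
    then show ?thesis using rooted_nth_less[of i n i'] i i' by simp
  next
    assume a: "upper n (Poly_Mapping.lookup M) = upper n (Poly_Mapping.lookup N) \<and>
      revlex_gt (lower n (Poly_Mapping.lookup M)) (lower n (Poly_Mapping.lookup N))"
    then have "rooted n ! i = rooted n ! i'" using i(3) i'(3) by (metis poly_mapping_eqI)
    then show ?thesis using rooted_nth_less[of j n j'] rooted_nth_inject[of i n i'] i i' a by simp
  qed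
  then show ?thesis unfolding rooted_gt_def using i i' lex_gt_pair_vec by simp
qed

lemma rooted_gt_asym:
  assumes n: "2 \<le> n" and M: "tight_cover 2 n (Poly_Mapping.lookup M)"
    and N: "tight_cover 2 n (Poly_Mapping.lookup N)" and gt: "rooted_gt n M N"
  shows "\<not> rooted_gt n N M"
proof -
  \<comment> \<open>\<open>max_expr\<close> is a definite description, so even its length is known
    only through \<open>max_expr_eq\<close>.\<close>
  have "length (max_expr n M) = length (max_expr n N)"
    by (metis max_expr_eq[OF n M] max_expr_eq[OF n N] length_pair_vec)
  then show ?thesis using gt lex_gt_asym unfolding rooted_gt_def by blast
qed

subsection \<open>Monomial ideals\<close>

lemma Sring_add: "f \<in> Sring n \<Longrightarrow> g \<in> Sring n \<Longrightarrow> f + g \<in> Sring n"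
  unfolding Sring_def using Poly_Mapping.keys_add[of f g] by blast

lemma Sring_sum: "(\<And>x. x \<in> A \<Longrightarrow> f x \<in> Sring n) \<Longrightarrow> sum f A \<in> Sring n"
proof (induction A rule: infinite_finite_induct)
  case (insert x F)
  then show ?case by (simp add: Sring_add)
qed (auto simp: Sring_def)

lemma Sring_single: "Poly_Mapping.keys u \<subseteq> {1..n} \<Longrightarrow> Poly_Mapping.single u c \<in> Sring n"
  unfolding Sring_def by auto

lemma keys_add_mon: "Poly_Mapping.keys (u + v :: mon) = Poly_Mapping.keys u \<union> Poly_Mapping.keys v"
  by (auto simp: in_keys_iff lookup_add)

lemma Sring_mult: "f \<in> Sring n \<Longrightarrow> g \<in> Sring n \<Longrightarrow> f * g \<in> Sring n"
  unfolding Sring_def using keys_mult[of f g] by (fastforce simp: keys_add_mon)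

text \<open>Each exponent of a combination of generators is an exponent of some generator plus a
  further exponent. Properties stable under such additions therefore pass from the generators to the
  ideal.\<close>

lemma keys_ideal_gen_subset:
  assumes f: "f \<in> ideal_gen n G" and P: "\<And>g t. g \<in> G \<Longrightarrow> t \<in> Poly_Mapping.keys g \<Longrightarrow> P t"
    and up: "\<And>s t. P t \<Longrightarrow> P (s + t)"
    and t: "t \<in> Poly_Mapping.keys f"
  shows "P t"
proof -
  obtain H c where H: "f = (\<Sum>g\<in>H. c g * g)" "finite H" "H \<subseteq> G"
    using f unfolding ideal_gen_def by auto
  have "t \<in> (\<Union>g\<in>H. Poly_Mapping.keys (c g * g))"
    using t keys_sum[of "\<lambda>g. c g * g" H] unfolding H(1) by blast
  then obtain g where g: "g \<in> H" "t \<in> Poly_Mapping.keys (c g * g)" by blast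
  then obtain a b where "t = a + b" "b \<in> Poly_Mapping.keys g" using keys_mult[of "c g" g] by blast
  then show ?thesis using P up g H(3) by blast
qed

lemma ideal_gen_subset_Sring:
  assumes "G \<subseteq> Sring n"
  shows "ideal_gen n G \<subseteq> Sring n"
  unfolding ideal_gen_def using assms by (auto intro!: Sring_sum Sring_mult)

lemma mult_in_ideal_gen: "c \<in> Sring n \<Longrightarrow> g \<in> G \<Longrightarrow> c * g \<in> ideal_gen n G"
  unfolding ideal_gen_def by (rule CollectI, rule exI[of _ "{g}"], rule exI[of _ "\<lambda>_. c"]) auto

lemma mdvd_add_diff: "mdvd u t \<Longrightarrow> t = (t - u) + u"
  by (rule poly_mapping_eqI) (simp add: mdvd_def lookup_add lookup_minus)

lemma keys_diff_mon: "Poly_Mapping.keys (t - u :: mon) \<subseteq> Poly_Mapping.keys t"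
  by (auto simp: in_keys_iff lookup_minus)

lemma sum_monomials:
  "f = (\<Sum>t\<in>Poly_Mapping.keys f. Poly_Mapping.single t (Poly_Mapping.lookup f t))"
  by (rule poly_mapping_eqI) (simp add: lookup_sum lookup_single when_def in_keys_iff)

text \<open>Reduces membership to divisibility, one monomial at a time. For sufficiency each term is
  assigned one generator that divides it.\<close>

lemma monomial_ideal_iff:
  fixes f :: "'a::field mpoly"
  assumes G: "\<And>u. u \<in> G \<Longrightarrow> Poly_Mapping.keys u \<subseteq> {1..n}"
  shows "f \<in> ideal_gen n (xmon ` G) \<longleftrightarrow>
    f \<in> Sring n \<and> (\<forall>t \<in> Poly_Mapping.keys f. \<exists>u\<in>G. mdvd u t)"
proof
  assume f: "f \<in> ideal_gen n (xmon ` G)"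
  have "xmon ` G \<subseteq> (Sring n :: 'a mpoly set)" using G by (auto simp: xmon_def Sring_single)
  then have "f \<in> Sring n" using f ideal_gen_subset_Sring by blast
  moreover have "\<exists>u\<in>G. mdvd u t" if "t \<in> Poly_Mapping.keys f" for t
    using f _ _ that
  proof (rule keys_ideal_gen_subset)
    show "\<exists>u\<in>G. mdvd u t" if "g \<in> xmon ` G" "t \<in> Poly_Mapping.keys g" for g :: "'a mpoly" and t
      using that by (auto simp: xmon_def mdvd_def)
    show "\<exists>u\<in>G. mdvd u (s + t)" if "\<exists>u\<in>G. mdvd u t" for s t
      using that unfolding mdvd_def lookup_add by (meson trans_le_add2)
  qed
  ultimately show "f \<in> Sring n \<and> (\<forall>t \<in> Poly_Mapping.keys f. \<exists>u\<in>G. mdvd u t)" by blast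
next
  assume f: "f \<in> Sring n \<and> (\<forall>t \<in> Poly_Mapping.keys f. \<exists>u\<in>G. mdvd u t)"
  then obtain d where d: "\<And>t. t \<in> Poly_Mapping.keys f \<Longrightarrow> d t \<in> G \<and> mdvd (d t) t" by metis
  \<comment> \<open>\<open>ideal_gen\<close> allows one coefficient per generator, so the cofactors
    of all terms assigned to \<open>g\<close> are collected.\<close>
  define c :: "'a mpoly \<Rightarrow> 'a mpoly" where
    "c g = (\<Sum>t\<in>{t \<in> Poly_Mapping.keys f. xmon (d t) = g}. Poly_Mapping.single (t - d t) (Poly_Mapping.lookup f t))" for g
  have mono: "Poly_Mapping.single t (Poly_Mapping.lookup f t) =
      Poly_Mapping.single (t - d t) (Poly_Mapping.lookup f t) * xmon (d t)" if "t \<in> Poly_Mapping.keys f" for t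
    using mdvd_add_diff[of "d t" t] d[OF that] by (simp add: xmon_def mult_single)
  have "f = (\<Sum>t\<in>Poly_Mapping.keys f. Poly_Mapping.single t (Poly_Mapping.lookup f t))"
    by (rule sum_monomials)
  also have "\<dots> = (\<Sum>t\<in>Poly_Mapping.keys f. Poly_Mapping.single (t - d t) (Poly_Mapping.lookup f t) * xmon (d t))"
    using mono by (rule sum.cong[OF refl])
  also have "\<dots> = (\<Sum>g\<in>(\<lambda>t. xmon (d t) :: 'a mpoly) ` Poly_Mapping.keys f.
      \<Sum>t\<in>{t \<in> Poly_Mapping.keys f. xmon (d t) = g}. Poly_Mapping.single (t - d t) (Poly_Mapping.lookup f t) * xmon (d t))"
    by (rule sum.image_gen) simp
  also have "\<dots> = (\<Sum>g\<in>(\<lambda>t. xmon (d t)) ` Poly_Mapping.keys f. c g * g)"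
    unfolding c_def sum_distrib_right by (intro sum.cong) auto
  finally have "f = (\<Sum>g\<in>(\<lambda>t. xmon (d t)) ` Poly_Mapping.keys f. c g * g)" .
  moreover have "c g \<in> Sring n" for g
    unfolding c_def
  proof (intro Sring_sum Sring_single)
    fix t assume "t \<in> {t \<in> Poly_Mapping.keys f. xmon (d t) = g}"
    then show "Poly_Mapping.keys (t - d t) \<subseteq> {1..n}"
      using f keys_diff_mon[of t "d t"] unfolding Sring_def by blast
  qed
  moreover have "(\<lambda>t. xmon (d t)) ` Poly_Mapping.keys f \<subseteq> xmon ` G" using d by blast
  ultimately show "f \<in> ideal_gen n (xmon ` G)"
    unfolding ideal_gen_def
    by (intro CollectI exI[of _ "(\<lambda>t. xmon (d t)) ` Poly_Mapping.keys f"] exI[of _ c] conjI) auto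
qed

text \<open>Multiplication by a monomial shifts exponents injectively, so no terms cancel. This
  makes the colon by a monomial computable term by term.\<close>

lemma keys_mult_xmon:
  "Poly_Mapping.keys (g * xmon u :: 'a::field mpoly) = (\<lambda>t. t + u) ` Poly_Mapping.keys g"
proof
  show "Poly_Mapping.keys (g * xmon u) \<subseteq> (\<lambda>t. t + u) ` Poly_Mapping.keys g"
    using keys_mult[of g "xmon u"] by (auto simp: xmon_def)
  have "g * xmon u = (\<Sum>s\<in>Poly_Mapping.keys g. Poly_Mapping.single s (Poly_Mapping.lookup g s)) * xmon u"
    by (simp flip: sum_monomials)
  also have "\<dots> = (\<Sum>s\<in>Poly_Mapping.keys g. Poly_Mapping.single (s + u) (Poly_Mapping.lookup g s))"
    by (simp add: sum_distrib_right xmon_def mult_single)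
  finally have "Poly_Mapping.lookup (g * xmon u) (t + u) = Poly_Mapping.lookup g t" for t
    by (simp add: lookup_sum lookup_single when_def in_keys_iff)
  then show "(\<lambda>t. t + u) ` Poly_Mapping.keys g \<subseteq> Poly_Mapping.keys (g * xmon u)"
    by (auto simp: in_keys_iff)
qed

subsection \<open>The square of the cover ideal\<close>

lemma lookup_cover_mon:
  assumes "finite C"
  shows "Poly_Mapping.lookup (cover_mon C) i = of_bool (i \<in> C)"
  using assms unfolding cover_mon_def by (simp add: lookup_sum lookup_var of_bool_def)

lemma min_vertex_cover_exists:
  assumes "vertex_cover n C"
  obtains D where "D \<subseteq> C" "min_vertex_cover n D"
proof -
  have fin: "finite {D. D \<subseteq> C \<and> vertex_cover n D}"
    by (rule finite_subset[of _ "Pow C"])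
      (use assms finite_subset in \<open>auto simp: vertex_cover_def intro: finite_subset[of _ "{1..n}"]\<close>)
  have ne: "{D. D \<subseteq> C \<and> vertex_cover n D} \<noteq> {}" using assms by blast
  obtain D where D: "D \<subseteq> C" "vertex_cover n D"
      and min: "\<forall>E\<in>{D. D \<subseteq> C \<and> vertex_cover n D}. E \<subseteq> D \<longrightarrow> D = E"
    using finite_has_minimal[OF fin ne] by auto
  have "\<not> vertex_cover n E" if "E \<subset> D" for E
    using that min D(1) by auto
  then show thesis using that[of D] D unfolding min_vertex_cover_def by simp
qed

lemma mon_keys_cover: "path_cover d n (Poly_Mapping.lookup u) \<Longrightarrow> Poly_Mapping.keys u \<subseteq> {1..n}"
  unfolding path_cover_def by (auto simp: in_keys_iff)

lemma cover_ideal_keys: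
  assumes "f \<in> (cover_ideal n :: 'a::field mpoly set)" "t \<in> Poly_Mapping.keys f"
  shows "\<forall>i. 1 \<le> i \<and> i < n \<longrightarrow> 1 \<le> Poly_Mapping.lookup t i + Poly_Mapping.lookup t (Suc i)"
  using assms(1)[unfolded cover_ideal_def] _ _ assms(2)
proof (rule keys_ideal_gen_subset)
  fix g :: "'a mpoly" and t
  assume "g \<in> {xmon (cover_mon C) |C. min_vertex_cover n C}" "t \<in> Poly_Mapping.keys g"
  then obtain C where "vertex_cover n C" "t = cover_mon C"
    unfolding min_vertex_cover_def xmon_def by auto
  moreover from this have "finite C" unfolding vertex_cover_def by (auto intro: finite_subset)
  ultimately show "\<forall>i. 1 \<le> i \<and> i < n \<longrightarrow> 1 \<le> Poly_Mapping.lookup t i + Poly_Mapping.lookup t (Suc i)"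
    unfolding vertex_cover_def by (auto simp: lookup_cover_mon)
qed (auto simp: lookup_add trans_le_add2)

lemma cover_ideal_subset_Sring: "(cover_ideal n :: 'a::field mpoly set) \<subseteq> Sring n"
  unfolding cover_ideal_def
proof (rule ideal_gen_subset_Sring, safe)
  fix C assume "min_vertex_cover n C"
  then have C: "C \<subseteq> {1..n}" unfolding min_vertex_cover_def vertex_cover_def by blast
  then have "finite C" by (rule finite_subset) simp
  then have "Poly_Mapping.keys (cover_mon C) \<subseteq> {1..n}"
    using C by (auto simp: in_keys_iff lookup_cover_mon)
  then show "(xmon (cover_mon C) :: 'a mpoly) \<in> Sring n" unfolding xmon_def by (rule Sring_single)
qed

text \<open>Exponents in the cover ideal have weight at least 1 on each edge, and weights add in
  products. Conversely a 2-cover splits into two vertex covers; weights above 2 may occur here,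
  beyond the reach of \<open>upper_cover\<close>.\<close>

lemma xmon_mem_cover_ideal_sq:
  "(xmon u :: 'a::field mpoly) \<in> cover_ideal_sq n \<longleftrightarrow> path_cover 2 n (Poly_Mapping.lookup u)"
proof
  assume u: "(xmon u :: 'a mpoly) \<in> cover_ideal_sq n"
  let ?P = "\<lambda>t. \<forall>i. 1 \<le> i \<and> i < n \<longrightarrow> 2 \<le> Poly_Mapping.lookup t i + Poly_Mapping.lookup t (Suc i)"
  have "(xmon u :: 'a mpoly) \<in> Sring n"
  proof -
    have "{f * g |f g. f \<in> (cover_ideal n :: 'a mpoly set) \<and> g \<in> cover_ideal n} \<subseteq> Sring n"
      using cover_ideal_subset_Sring[of n, where 'a = 'a] by (auto intro!: Sring_mult)
    then show ?thesis
      using u ideal_gen_subset_Sring unfolding cover_ideal_sq_def ideal_prod_def by blast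
  qed
  then have "Poly_Mapping.keys u \<subseteq> {1..n}" unfolding Sring_def xmon_def by simp
  moreover have "?P u"
    using u[unfolded cover_ideal_sq_def ideal_prod_def]
  proof (rule keys_ideal_gen_subset)
    fix h :: "'a mpoly" and t
    assume "h \<in> {f * g |f g. f \<in> cover_ideal n \<and> g \<in> cover_ideal n}" and t: "t \<in> Poly_Mapping.keys h"
    then obtain f g :: "'a mpoly" where fg: "h = f * g" "f \<in> cover_ideal n" "g \<in> cover_ideal n" by blast
    then obtain a b where ab: "t = a + b" "a \<in> Poly_Mapping.keys f" "b \<in> Poly_Mapping.keys g"
      using t keys_mult[of f g] by blast
    show "?P t"
      using cover_ideal_keys[OF fg(2) ab(2)] cover_ideal_keys[OF fg(3) ab(3)]
      by (fastforce simp: ab(1) lookup_add)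
  qed (auto simp: xmon_def lookup_add intro: order_trans[OF _ add_mono[OF le_add2 le_add2]])
  ultimately show "path_cover 2 n (Poly_Mapping.lookup u)"
    unfolding path_cover_def by (auto simp: subset_iff in_keys_iff)
next
  assume u: "path_cover 2 n (Poly_Mapping.lookup u)"
  \<comment> \<open>Edges with both weights equal to 1 are split by the parity of their endpoints.\<close>
  define C where "C = {i. 2 \<le> Poly_Mapping.lookup u i \<or> Poly_Mapping.lookup u i = 1 \<and> even i}"
  define D where "D = {i. 2 \<le> Poly_Mapping.lookup u i \<or> Poly_Mapping.lookup u i = 1 \<and> odd i}"
  have "1 \<le> i \<and> i \<le> n" if "i \<in> C \<union> D" for i
    using that path_cover_outside[OF u, of i] unfolding C_def D_def by fastforce
  then have sub: "C \<subseteq> {1..n}" "D \<subseteq> {1..n}" by auto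
  have edge: "(i \<in> C \<or> Suc i \<in> C) \<and> (i \<in> D \<or> Suc i \<in> D)" if "1 \<le> i" "i < n" for i
  proof -
    have "2 \<le> Poly_Mapping.lookup u i \<or> 2 \<le> Poly_Mapping.lookup u (Suc i) \<or>
        Poly_Mapping.lookup u i = 1 \<and> Poly_Mapping.lookup u (Suc i) = 1"
      using path_cover_edge[OF u that] by linarith
    then show ?thesis unfolding C_def D_def by auto
  qed
  then have "vertex_cover n C" "vertex_cover n D" unfolding vertex_cover_def using sub by auto
  \<comment> \<open>The ideal is generated by minimal covers only, so both covers are shrunk and the
    surplus of \<open>u\<close> goes into the coefficient.\<close>
  then obtain C' D' where C': "C' \<subseteq> C" "min_vertex_cover n C'" and D': "D' \<subseteq> D" "min_vertex_cover n D'"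
    using min_vertex_cover_exists by metis
  have fin: "finite C'" "finite D'" using C'(1) D'(1) sub by (meson finite_atLeastAtMost finite_subset)+
  let ?c = "cover_mon C'" and ?d = "cover_mon D'"
  have "mdvd (?c + ?d) u"
    unfolding mdvd_def
  proof
    fix i
    show "Poly_Mapping.lookup (?c + ?d) i \<le> Poly_Mapping.lookup u i"
      using C'(1) D'(1) unfolding C_def D_def
      by (cases "i \<in> C'"; cases "i \<in> D'"; simp add: lookup_add lookup_cover_mon fin; force)
  qed
  then have "u = (u - (?c + ?d)) + (?c + ?d)" by (rule mdvd_add_diff)
  then have "(xmon u :: 'a mpoly) = xmon (u - (?c + ?d)) * (xmon ?c * xmon ?d)"
    by (simp add: xmon_def mult_single)
  moreover have "xmon (u - (?c + ?d)) * (xmon ?c * xmon ?d :: 'a mpoly) \<in> cover_ideal_sq n"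
    unfolding cover_ideal_sq_def ideal_prod_def
  proof (rule mult_in_ideal_gen)
    show "(xmon (u - (?c + ?d)) :: 'a mpoly) \<in> Sring n"
      unfolding xmon_def using mon_keys_cover[OF u] keys_diff_mon[of u "?c + ?d"] by (intro Sring_single) blast
    have one: "(1 :: 'a mpoly) \<in> Sring n" unfolding Sring_def by simp
    have "1 * xmon ?c \<in> (cover_ideal n :: 'a mpoly set)" "1 * xmon ?d \<in> (cover_ideal n :: 'a mpoly set)"
      unfolding cover_ideal_def using C'(2) D'(2) by (intro mult_in_ideal_gen one; blast)+
    then show "xmon ?c * xmon ?d \<in> {f * g |f g. f \<in> (cover_ideal n :: 'a mpoly set) \<and> g \<in> cover_ideal n}"
      by auto
  qed
  ultimately show "(xmon u :: 'a mpoly) \<in> cover_ideal_sq n" by simp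
qed

text \<open>If no edge at \<open>i\<close> is tight, dividing by the variable at \<open>i\<close>
  leaves a 2-cover. Conversely a proper divisor is smaller at some vertex, and the tight edge there
  would fall below 2.\<close>

lemma min_mon_gens_cover_ideal_sq:
  "min_mon_gens n (cover_ideal_sq n :: 'a::field mpoly set) = {u. tight_cover 2 n (Poly_Mapping.lookup u)}"
proof (intro set_eqI iffI)
  fix u assume "u \<in> min_mon_gens n (cover_ideal_sq n :: 'a mpoly set)"
  then have c: "path_cover 2 n (Poly_Mapping.lookup u)"
    and m: "\<And>v. path_cover 2 n (Poly_Mapping.lookup v) \<Longrightarrow> mdvd v u \<Longrightarrow> v = u"
    unfolding min_mon_gens_def by (auto simp: xmon_mem_cover_ideal_sq)
  have "1 < i \<and> Poly_Mapping.lookup u (i - 1) + Poly_Mapping.lookup u i = 2 \<or>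
      i < n \<and> Poly_Mapping.lookup u i + Poly_Mapping.lookup u (Suc i) = 2"
    if pos: "0 < Poly_Mapping.lookup u i" for i
  proof (rule ccontr)
    assume no: "\<not> ?thesis"
    have v: "Poly_Mapping.lookup (u - var i) j = (if j = i then Poly_Mapping.lookup u i - 1 else Poly_Mapping.lookup u j)" for j
      by (simp add: lookup_minus lookup_var)
    have "2 \<le> Poly_Mapping.lookup (u - var i) j + Poly_Mapping.lookup (u - var i) (Suc j)"
      if j: "1 \<le> j" "j < n" for j
      using path_cover_edge[OF c j] no j unfolding v by auto
    moreover have "1 \<le> j \<and> j \<le> n" if "0 < Poly_Mapping.lookup (u - var i) j" for j
      using that path_cover_outside[OF c, of j] by (auto simp: v split: if_splits)
    ultimately have "path_cover 2 n (Poly_Mapping.lookup (u - var i))" unfolding path_cover_def by blast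
    moreover have "mdvd (u - var i) u" unfolding mdvd_def by (simp add: lookup_minus)
    ultimately have "u - var i = u" by (rule m)
    then show False using v[of i] pos by simp
  qed
  then show "u \<in> {u. tight_cover 2 n (Poly_Mapping.lookup u)}" using c unfolding tight_cover_def by simp
next
  fix u assume "u \<in> {u. tight_cover 2 n (Poly_Mapping.lookup u)}"
  then have u: "tight_cover 2 n (Poly_Mapping.lookup u)" by simp
  note p = tight_cover_imp_path_cover[OF u]
  have "v = u" if v: "path_cover 2 n (Poly_Mapping.lookup v)" and d: "mdvd v u" for v
  proof (rule poly_mapping_eqI, rule ccontr)
    fix i assume "Poly_Mapping.lookup v i \<noteq> Poly_Mapping.lookup u i"
    then have lt: "Poly_Mapping.lookup v i < Poly_Mapping.lookup u i" using d unfolding mdvd_def by (simp add: le_neq_implies_less)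
    have le: "Poly_Mapping.lookup v j \<le> Poly_Mapping.lookup u j" for j using d unfolding mdvd_def by simp
    have i: "1 \<le> i" "i \<le> n" using lt path_cover_outside[OF p, of i] by auto
    have "0 < Poly_Mapping.lookup u i" using lt by simp
    from tight_coverD[OF u this] show False
    proof
      assume a: "1 < i \<and> Poly_Mapping.lookup u (i - 1) + Poly_Mapping.lookup u i = 2"
      then have "2 \<le> Poly_Mapping.lookup v (i - 1) + Poly_Mapping.lookup v i"
        using path_cover_edge[OF v, of "i - 1"] i by auto
      then show False using a lt le[of "i - 1"] by linarith
    next
      assume a: "i < n \<and> Poly_Mapping.lookup u i + Poly_Mapping.lookup u (Suc i) = 2"
      then show False using path_cover_edge[OF v, of i] lt le[of "Suc i"] i by linarith
    qed
  qed
  then show "u \<in> min_mon_gens n (cover_ideal_sq n :: 'a mpoly set)"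
    unfolding min_mon_gens_def using p mon_keys_cover[OF p] by (auto simp: xmon_mem_cover_ideal_sq)
qed

section \<open>Linear quotients of the squared cover ideal\<close>

theorem theorem5p1:
  fixes n :: nat and Us :: "mon list"
  assumes "n \<ge> 2"
    and "set Us = min_mon_gens n (cover_ideal_sq n :: 'a::field mpoly set)"
    and "\<forall>i j. i < j \<and> j < length Us \<longrightarrow> rooted_gt n (Us ! i) (Us ! j)"
  shows "\<forall>r. 1 \<le> r \<and> r < length Us \<longrightarrow>
           (\<exists>S \<subseteq> {1..n}.
              colon n (ideal_gen n (xmon ` set (take r Us))) (xmon (Us ! r) :: 'a mpoly)
              = ideal_gen n ((\<lambda>i. xmon (var i)) ` S))"
proof (intro allI impI)
  fix r assume r: "1 \<le> r \<and> r < length Us"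
  define M where "M = Us ! r"
  define f where "f = Poly_Mapping.lookup M"
  have Us: "u \<in> set Us \<longleftrightarrow> tight_cover 2 n (Poly_Mapping.lookup u)" for u
    using assms(2) by (simp add: min_mon_gens_cover_ideal_sq)
  have M: "tight_cover 2 n f" using Us[of M] r unfolding M_def f_def by simp
  have keysM: "Poly_Mapping.keys M \<subseteq> {1..n}"
    using mon_keys_cover[OF tight_cover_imp_path_cover[OF M[unfolded f_def]]] .
  \<comment> \<open>Both ideals are monomial, so their equality reduces to this divisibility test on
    a single exponent \<open>t\<close>.\<close>
  have key: "(\<exists>u\<in>set (take r Us). mdvd u (t + M)) \<longleftrightarrow> (\<exists>v\<in>var ` movable n f. mdvd v t)" for t
  proof
    assume "\<exists>u\<in>set (take r Us). mdvd u (t + M)"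
    then obtain N where N: "N \<in> set (take r Us)" "mdvd N (t + M)" by blast
    have tN: "tight_cover 2 n (Poly_Mapping.lookup N)" using N(1) Us in_set_takeD by metis
    from N(1) obtain s where "s < r" "Us ! s = N" using r by (auto simp: in_set_conv_nth)
    then have gt: "rooted_gt n N M" using assms(3) r unfolding M_def by auto
    then have ngt: "\<not> rooted_gt n M N" using rooted_gt_asym assms(1) tN M unfolding f_def by blast
    have "\<not> (Poly_Mapping.lookup N = f \<or> revlex_gt (upper n f) (upper n (Poly_Mapping.lookup N)) \<or>
      upper n f = upper n (Poly_Mapping.lookup N) \<and> revlex_gt (lower n f) (lower n (Poly_Mapping.lookup N)))"
      using ngt gt rooted_gtI[OF assms(1) _ tN, of M] M poly_mapping_eqI[of N M] unfolding f_def by auto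
    then obtain k where k: "k \<in> movable n f" "f k < Poly_Mapping.lookup N k"
      using no_move_imp_less[OF M tN] not_le by blast
    then have "0 < Poly_Mapping.lookup t k"
      using N(2)[unfolded mdvd_def, rule_format, of k] unfolding f_def by (simp add: lookup_add)
    then have "mdvd (var k) t" unfolding mdvd_def by (simp add: lookup_var)
    then show "\<exists>v\<in>var ` movable n f. mdvd v t" using k(1) by blast
  next
    assume "\<exists>v\<in>var ` movable n f. mdvd v t"
    then obtain k where k: "k \<in> movable n f" "mdvd (var k) t" by blast
    have tk: "1 \<le> Poly_Mapping.lookup t k"
      using k(2)[unfolded mdvd_def, rule_format, of k] by (simp add: lookup_var)
    define T where "T = Abs_poly_mapping (move k f)"
    note mt = move_tight[OF M k(1)]
    have T: "Poly_Mapping.lookup T = move k f"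
      unfolding T_def by (rule lookup_Abs_cover[OF tight_cover_imp_path_cover[OF mt]])
    have gt: "rooted_gt n T M"
      by (rule rooted_gtI[OF assms(1)]) (use mt M move_greater[OF M k(1)] in \<open>auto simp: T f_def\<close>)
    then have ngt: "\<not> rooted_gt n M T" using rooted_gt_asym[OF assms(1)] mt M T unfolding f_def by metis
    have "T \<in> set Us" using Us mt T by simp
    then obtain s where s: "s < length Us" "Us ! s = T" by (metis in_set_conv_nth)
    \<comment> \<open>The list is decreasing, so the position of \<open>T\<close> must be before
      that of \<open>M\<close>: the other positions contradict asymmetry.\<close>
    have "\<not> r < s" "r \<noteq> s" using s ngt gt assms(3) unfolding M_def by auto
    then have "s < r" by simp
    then have "T \<in> set (take r Us)" using s by (auto simp: in_set_conv_nth)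
    \<comment> \<open>The move raises only the exponent at \<open>k\<close>, by one, and
      \<open>t\<close> supplies that one.\<close>
    moreover have "mdvd T (t + M)"
      unfolding mdvd_def T using tk by (auto simp: lookup_add move_def f_def)
    ultimately show "\<exists>u\<in>set (take r Us). mdvd u (t + M)" by blast
  qed
  have keysU: "Poly_Mapping.keys u \<subseteq> {1..n}" if "u \<in> set (take r Us)" for u
    using that Us in_set_takeD mon_keys_cover tight_cover_imp_path_cover by metis
  have sub: "movable n f \<subseteq> {1..n}" unfolding movable_def by auto
  have keysV: "Poly_Mapping.keys v \<subseteq> {1..n}" if "v \<in> var ` movable n f" for v
    using that sub by (auto simp: var_def)
  have "colon n (ideal_gen n (xmon ` set (take r Us))) (xmon M) =
      ideal_gen n (xmon ` var ` movable n f :: 'a mpoly set)"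
  proof (rule set_eqI)
    fix g :: "'a mpoly"
    have "g * xmon M \<in> Sring n" if "g \<in> Sring n"
      using that keysM by (simp add: Sring_mult Sring_single xmon_def)
    then show "g \<in> colon n (ideal_gen n (xmon ` set (take r Us))) (xmon M) \<longleftrightarrow>
        g \<in> ideal_gen n (xmon ` var ` movable n f)"
      unfolding colon_def
      by (auto simp: monomial_ideal_iff[OF keysU] monomial_ideal_iff[OF keysV] keys_mult_xmon key)
  qed
  then show "\<exists>S \<subseteq> {1..n}. colon n (ideal_gen n (xmon ` set (take r Us))) (xmon (Us ! r) :: 'a mpoly)
      = ideal_gen n ((\<lambda>i. xmon (var i)) ` S)"
    using sub unfolding M_def by (auto simp: image_image)
qed

end
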